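(* (a) If $R$ is a regular ultrametric unital Banach ring, then $\sigma^{\mathrm{um}}_R(a)\neq\emptyset$ for every $a\in R$. (b) Let $R$ be a non-zero unital ring and let $R_0$ denote $R$ equipped with the trivial norm ($\|x\|=1$ for $x\ne0$, $\|0\|=0$). Then $\sigma^{\mathrm{um}}_{R_0}(a)\ne\emptyset$ for every $a\in R$.
   Context: A unital Banach ring is a ring with identity complete w.r.t. a submultiplicative norm with $\|1\|=1$; it is ultrametric if $\|x+y\|\le\max\{\|x\|,\|y\|\}$, and regular if $\|m\cdot a\|=\|m\cdot1\|\,\|a\|$ for all $m\in\mathbb Z$, $a\in R$. $\mathbb A$ is the set of non-zero multiplicative semi-norms on $\mathbb Z[t]$; for a complete valuation field $K$ and $s\in K$, $\mu_K(s)\in\mathbb A$ is $p\mapsto|p(s)|_K$. On $R\otimes_{\mathbb Z}K$ ($\mathbb Z$ with Euclidean absolute value) let $\|z\|^{\mathrm{um}}_\wedge=\inf\max_k\|a_k\||b_k|$ over representations $z=\sum a_k\otimes b_k$, and let $R\hat\otimes^{\mathrm{um}}_{\mathbb Z}K$ be the completion modulo its kernel. $\sigma^{\mathrm{um}}_R(a):=\{\mu_K(s): K$ complete valuation field, $s\in K$, $R\hat\otimes^{\mathrm{um}}_{\mathbb Z}K\neq(0)$ and $1\otimes s-a\otimes1$ is not invertible in $R\hat\otimes^{\mathrm{um}}_{\mathbb Z}K\}$. *)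

theory Defs
  imports "HOL-Algebra.Ring" "HOL-Computational_Algebra.Polynomial" Complex_Main
begin

definition banach_ring :: "('r,'m) ring_scheme \<Rightarrow> ('r \<Rightarrow> real) \<Rightarrow> bool" where
  "banach_ring R nr \<longleftrightarrow> ring R \<and>
     (\<forall>x\<in>carrier R. 0 \<le> nr x) \<and>
     (\<forall>x\<in>carrier R. nr x = 0 \<longleftrightarrow> x = \<zero>\<^bsub>R\<^esub>) \<and>
     (\<forall>x\<in>carrier R. \<forall>y\<in>carrier R. nr (x \<oplus>\<^bsub>R\<^esub> y) \<le> nr x + nr y) \<and>
     (\<forall>x\<in>carrier R. nr (\<ominus>\<^bsub>R\<^esub> x) = nr x) \<and>
     (\<forall>x\<in>carrier R. \<forall>y\<in>carrier R. nr (x \<otimes>\<^bsub>R\<^esub> y) \<le> nr x * nr y) \<and>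
     nr \<one>\<^bsub>R\<^esub> = 1 \<and>
     (\<forall>X. (\<forall>n. X n \<in> carrier R) \<and>
          (\<forall>e>0. \<exists>N. \<forall>m\<ge>N. \<forall>n\<ge>N. nr (X m \<ominus>\<^bsub>R\<^esub> X n) < e) \<longrightarrow>
          (\<exists>L\<in>carrier R. (\<lambda>n. nr (X n \<ominus>\<^bsub>R\<^esub> L)) \<longlonglongrightarrow> 0))"

definition ultrametric :: "('r,'m) ring_scheme \<Rightarrow> ('r \<Rightarrow> real) \<Rightarrow> bool" where
  "ultrametric R nr \<longleftrightarrow>
     (\<forall>x\<in>carrier R. \<forall>y\<in>carrier R. nr (x \<oplus>\<^bsub>R\<^esub> y) \<le> max (nr x) (nr y))"

definition regular :: "('r,'m) ring_scheme \<Rightarrow> ('r \<Rightarrow> real) \<Rightarrow> bool" where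
  "regular R nr \<longleftrightarrow>
     (\<forall>m::int. \<forall>a\<in>carrier R. nr ([m] \<cdot>\<^bsub>R\<^esub> a) = nr ([m] \<cdot>\<^bsub>R\<^esub> \<one>\<^bsub>R\<^esub>) * nr a)"

definition trivial_norm :: "('r,'m) ring_scheme \<Rightarrow> 'r \<Rightarrow> real" where
  "trivial_norm R x = (if x = \<zero>\<^bsub>R\<^esub> then 0 else 1)"

definition complete_valued_field :: "('k,'m) ring_scheme \<Rightarrow> ('k \<Rightarrow> real) \<Rightarrow> bool" where
  "complete_valued_field K v \<longleftrightarrow> field K \<and>
     (\<forall>x\<in>carrier K. 0 \<le> v x) \<and>
     (\<forall>x\<in>carrier K. v x = 0 \<longleftrightarrow> x = \<zero>\<^bsub>K\<^esub>) \<and>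
     (\<forall>x\<in>carrier K. \<forall>y\<in>carrier K. v (x \<otimes>\<^bsub>K\<^esub> y) = v x * v y) \<and>
     (\<forall>x\<in>carrier K. \<forall>y\<in>carrier K. v (x \<oplus>\<^bsub>K\<^esub> y) \<le> v x + v y) \<and>
     (\<forall>X. (\<forall>n. X n \<in> carrier K) \<and>
          (\<forall>e>0. \<exists>N. \<forall>m\<ge>N. \<forall>n\<ge>N. v (X m \<ominus>\<^bsub>K\<^esub> X n) < e) \<longrightarrow>
          (\<exists>L\<in>carrier K. (\<lambda>n. v (X n \<ominus>\<^bsub>K\<^esub> L)) \<longlonglongrightarrow> 0))"

definition mu_point :: "('k,'m) ring_scheme \<Rightarrow> ('k \<Rightarrow> real) \<Rightarrow> 'k \<Rightarrow> int poly \<Rightarrow> real" where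
  "mu_point K v s = (\<lambda>p. v (\<Oplus>\<^bsub>K\<^esub> i\<in>{..degree p}. [coeff p i] \<cdot>\<^bsub>K\<^esub> (s [^]\<^bsub>K\<^esub> i)))"

text \<open>Elements of the free abelian group on \<open>R \<times> K\<close> are finitely supported
 integer-valued functions; \<open>R \<otimes>\<^sub>\<int> K\<close> is its quotient by the subgroup
 generated by the bilinearity relations.\<close>

definition fsums :: "('r,'a) ring_scheme \<Rightarrow> ('k,'b) ring_scheme \<Rightarrow> ('r \<times> 'k \<Rightarrow> int) set" where
  "fsums R K = {f. finite {p. f p \<noteq> 0} \<and> {p. f p \<noteq> 0} \<subseteq> carrier R \<times> carrier K}"

definition tfs :: "('r \<times> 'k) list \<Rightarrow> ('r \<times> 'k \<Rightarrow> int)" where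
  "tfs L = (\<lambda>p. int (count_list L p))"

inductive_set tensor_rel :: "('r,'a) ring_scheme \<Rightarrow> ('k,'b) ring_scheme \<Rightarrow> ('r \<times> 'k \<Rightarrow> int) set"
  for R K where
  zero: "(\<lambda>_. 0) \<in> tensor_rel R K"
| left: "\<lbrakk>a \<in> carrier R; a' \<in> carrier R; b \<in> carrier K\<rbrakk> \<Longrightarrow>
     (\<lambda>p. tfs [(a \<oplus>\<^bsub>R\<^esub> a', b)] p - tfs [(a, b)] p - tfs [(a', b)] p) \<in> tensor_rel R K"
| right: "\<lbrakk>a \<in> carrier R; b \<in> carrier K; b' \<in> carrier K\<rbrakk> \<Longrightarrow>
     (\<lambda>p. tfs [(a, b \<oplus>\<^bsub>K\<^esub> b')] p - tfs [(a, b)] p - tfs [(a, b')] p) \<in> tensor_rel R K"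
| add: "\<lbrakk>f \<in> tensor_rel R K; g \<in> tensor_rel R K\<rbrakk> \<Longrightarrow> (\<lambda>p. f p + g p) \<in> tensor_rel R K"
| neg: "f \<in> tensor_rel R K \<Longrightarrow> (\<lambda>p. - f p) \<in> tensor_rel R K"

definition teq :: "('r,'a) ring_scheme \<Rightarrow> ('k,'b) ring_scheme \<Rightarrow> ('r \<times> 'k \<Rightarrow> int) \<Rightarrow> ('r \<times> 'k \<Rightarrow> int) \<Rightarrow> bool" where
  "teq R K f g \<longleftrightarrow> (\<lambda>p. f p - g p) \<in> tensor_rel R K"

definition tdiff :: "('r \<times> 'k \<Rightarrow> int) \<Rightarrow> ('r \<times> 'k \<Rightarrow> int) \<Rightarrow> ('r \<times> 'k \<Rightarrow> int)" where
  "tdiff f g = (\<lambda>p. f p - g p)"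

definition tmult :: "('r,'a) ring_scheme \<Rightarrow> ('k,'b) ring_scheme \<Rightarrow> ('r \<times> 'k \<Rightarrow> int) \<Rightarrow> ('r \<times> 'k \<Rightarrow> int) \<Rightarrow> ('r \<times> 'k \<Rightarrow> int)" where
  "tmult R K f g = (\<lambda>q. \<Sum>(p1, p2) \<in> {p. f p \<noteq> 0} \<times> {p. g p \<noteq> 0}.
      (if (fst p1 \<otimes>\<^bsub>R\<^esub> fst p2, snd p1 \<otimes>\<^bsub>K\<^esub> snd p2) = q then f p1 * g p2 else 0))"

definition tone :: "('r,'a) ring_scheme \<Rightarrow> ('k,'b) ring_scheme \<Rightarrow> ('r \<times> 'k \<Rightarrow> int)" where
  "tone R K = tfs [(\<one>\<^bsub>R\<^esub>, \<one>\<^bsub>K\<^esub>)]"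

definition telem :: "('r,'a) ring_scheme \<Rightarrow> ('k,'b) ring_scheme \<Rightarrow> 'r \<Rightarrow> 'k \<Rightarrow> ('r \<times> 'k \<Rightarrow> int)" where
  "telem R K a s = tdiff (tfs [(\<one>\<^bsub>R\<^esub>, s)]) (tfs [(a, \<one>\<^bsub>K\<^esub>)])"

text \<open>The ultrametric projective semi-norm
 \<open>\<parallel>z\<parallel>\<^sup>u\<^sup>m = inf max\<^sub>k \<parallel>a_k\<parallel> |b_k|\<close> over all representations \<open>z = \<Sum> a_k \<otimes> b_k\<close>
 (the empty sum having value 0).\<close>
definition tnorm :: "('r,'a) ring_scheme \<Rightarrow> ('k,'b) ring_scheme \<Rightarrow> ('r \<Rightarrow> real) \<Rightarrow> ('k \<Rightarrow> real) \<Rightarrow> ('r \<times> 'k \<Rightarrow> int) \<Rightarrow> real" where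
  "tnorm R K nr v f = Inf {Max (insert 0 ((\<lambda>(a, b). nr a * v b) ` set L)) | L.
       set L \<subseteq> carrier R \<times> carrier K \<and> teq R K (tfs L) f}"

text \<open>The completion of \<open>R \<otimes>\<^sub>\<int> K\<close> modulo the kernel of the semi-norm is the zero
 ring iff the unit \<open>1 \<otimes> 1\<close> has semi-norm 0.\<close>
definition tcompl_nonzero :: "('r,'a) ring_scheme \<Rightarrow> ('k,'b) ring_scheme \<Rightarrow> ('r \<Rightarrow> real) \<Rightarrow> ('k \<Rightarrow> real) \<Rightarrow> bool" where
  "tcompl_nonzero R K nr v \<longleftrightarrow> tnorm R K nr v (tone R K) \<noteq> 0"

text \<open>An element \<open>x\<close> of \<open>R \<otimes>\<^sub>\<int> K\<close> is invertible in the completion iff there is a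
 Cauchy sequence \<open>y\<^sub>n\<close> in \<open>R \<otimes>\<^sub>\<int> K\<close> (representing an element \<open>y\<close> of the completion)
 with \<open>x y\<^sub>n \<rightarrow> 1\<close> and \<open>y\<^sub>n x \<rightarrow> 1\<close>, i.e. \<open>x y = y x = 1\<close>.\<close>
definition tcompl_invertible :: "('r,'a) ring_scheme \<Rightarrow> ('k,'b) ring_scheme \<Rightarrow> ('r \<Rightarrow> real) \<Rightarrow> ('k \<Rightarrow> real) \<Rightarrow> ('r \<times> 'k \<Rightarrow> int) \<Rightarrow> bool" where
  "tcompl_invertible R K nr v x \<longleftrightarrow>
     (\<exists>y. (\<forall>n. y n \<in> fsums R K) \<and>
          (\<forall>e>0. \<exists>N. \<forall>m\<ge>N. \<forall>n\<ge>N. tnorm R K nr v (tdiff (y m) (y n)) < e) \<and>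
          (\<lambda>n. tnorm R K nr v (tdiff (tmult R K x (y n)) (tone R K))) \<longlonglongrightarrow> 0 \<and>
          (\<lambda>n. tnorm R K nr v (tdiff (tmult R K (y n) x) (tone R K))) \<longlonglongrightarrow> 0)"

definition sigma_um :: "('r,'a) ring_scheme \<Rightarrow> ('r \<Rightarrow> real) \<Rightarrow> 'r \<Rightarrow> (int poly \<Rightarrow> real) set" where
  "sigma_um R nr a = {mu_point K v s | (K :: real ring) v s.
      complete_valued_field K v \<and> s \<in> carrier K \<and>
      tcompl_nonzero R K nr v \<and>
      \<not> tcompl_invertible R K nr v (telem R K a s)}"

end

theory Submission
  imports Defs "HOL-Analysis.Abstract_Topology_2" "HOL-Computational_Algebra.Fraction_Field"
begin

text \<open>
  For an ultrametric seminorm \<open>w\<close> on \<open>\<int>[t]\<close> let \<open>N\<^sub>w(r)\<close> be the infimum of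
  \<open>max\<^sub>k w(f\<^sub>k) \<parallel>r\<^sub>k\<parallel>\<close> over all representations \<open>r = \<Sum>\<^sub>k f\<^sub>k(a) r\<^sub>k\<close>; below, \<open>ball w \<epsilon>\<close>
  is the set of all \<open>r\<close> with \<open>N\<^sub>w(r) < \<epsilon>\<close>.  The submultiplicative seminorms \<open>w\<close> with
  \<open>N\<^sub>w(1) \<ge> 1\<close> include \<open>f \<mapsto> \<parallel>f(a)\<parallel>\<close>, and by Zorn's lemma there is a minimal one.  Since any
  attempt to decrease \<open>w\<close> must fail, the minimal \<open>w\<close> is multiplicative and satisfies
  \<open>N\<^sub>w(g(a)) \<ge> w(g)\<close> for all \<open>g\<close>.  Take \<open>K\<close> to be the completion of the fraction field of
  \<open>\<int>[t] / ker w\<close> and \<open>s\<close> the class of \<open>t\<close>.  If \<open>R \<otimes> K\<close> were zero, or \<open>1 \<otimes> s - a \<otimes> 1\<close> right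
  invertible in its completion, then \<open>1 \<otimes> 1\<close> would be congruent, modulo the image of
  \<open>1 \<otimes> s - a \<otimes> 1\<close>, to a sum of tensors of norm less than 1.  Clearing denominators and
  sending \<open>r \<otimes> f\<close> to \<open>f(a) r\<close>, which kills that image, would give some \<open>g\<close> with
  \<open>N\<^sub>w(g(a)) < w(g)\<close>.  Part (b) is the case of the trivial norm.
\<close>

section \<open>Completion of a countable valued ring inside the reals\<close>

text \<open>A sequence in a countable set is determined by its graph, coded as a set of naturals,
  and there are only continuum many of those. This lets the completion live on the type
  \<open>real\<close>, as the spectrum admits only fields of type \<open>real ring\<close>.\<close>

lemma ex_inj_on_sequences_into_real:
  assumes "countable S"
  shows "\<exists>c :: (nat \<Rightarrow> 'f) \<Rightarrow> real. inj_on c {X. range X \<subseteq> S}"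
proof -
  obtain e :: "nat set \<Rightarrow> real" where e: "inj e"
    using eqpoll_imp_lepoll[OF nat_sets_eqpoll_reals] by (auto simp: lepoll_def)
  define graph :: "(nat \<Rightarrow> 'f) \<Rightarrow> nat set"
    where "graph X = range (\<lambda>n. prod_encode (n, to_nat_on S (X n)))" for X
  have "inj_on graph {X. range X \<subseteq> S}"
  proof (rule inj_onI, rule ext)
    fix X Y n assume X: "X \<in> {X. range X \<subseteq> S}" and Y: "Y \<in> {X. range X \<subseteq> S}"
      and eq: "graph X = graph Y"
    have "prod_encode (n, to_nat_on S (X n)) \<in> graph Y"
      unfolding eq[symmetric] unfolding graph_def by blast
    then have "to_nat_on S (X n) = to_nat_on S (Y n)"
      by (auto simp: graph_def prod_encode_eq)
    then show "X n = Y n"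
      using X Y to_nat_on_inj[OF assms, of "X n" "Y n"] by blast
  qed
  then have "inj_on (e \<circ> graph) {X. range X \<subseteq> S}"
    using e by (intro comp_inj_on) (auto intro: inj_on_subset)
  then show ?thesis by blast
qed

text \<open>The model is the localization of \<open>Z[t]\<close> at the prime ideal
  \<open>ker w\<close>, inside the fraction field. Non-zero elements of \<open>S\<close> may have
  value 0; \<open>inverse_S\<close> supplies inverses off that kernel, which is why the completion
  modulo null sequences is a field.\<close>

locale valued_subring =
  fixes S :: "'f :: field set" and w :: "'f \<Rightarrow> real"
  assumes countable_S: "countable S"
    and zero_S [simp]: "0 \<in> S" and one_S [simp]: "1 \<in> S"
    and add_S [simp]: "x \<in> S \<Longrightarrow> y \<in> S \<Longrightarrow> x + y \<in> S"
    and uminus_S [simp]: "x \<in> S \<Longrightarrow> - x \<in> S"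
    and mult_S [simp]: "x \<in> S \<Longrightarrow> y \<in> S \<Longrightarrow> x * y \<in> S"
    and inverse_S: "x \<in> S \<Longrightarrow> w x \<noteq> 0 \<Longrightarrow> inverse x \<in> S"
    and w_nonneg: "x \<in> S \<Longrightarrow> 0 \<le> w x"
    and w_zero [simp]: "w 0 = 0" and w_one [simp]: "w 1 = 1"
    and w_mult: "x \<in> S \<Longrightarrow> y \<in> S \<Longrightarrow> w (x * y) = w x * w y"
    and w_add: "x \<in> S \<Longrightarrow> y \<in> S \<Longrightarrow> w (x + y) \<le> max (w x) (w y)"
begin

lemma diff_S [simp]: "x \<in> S \<Longrightarrow> y \<in> S \<Longrightarrow> x - y \<in> S"
  using add_S[of x "- y"] by simp

lemma w_uminus: assumes "x \<in> S" shows "w (- x) = w x"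
proof -
  have "w (- 1) * w (- 1) = 1"
    using w_mult[of "-1" "-1"] by simp
  then have "w (- 1) = 1"
    using w_nonneg[of "- 1"] by (metis abs_of_nonneg abs_mult_self_eq mult_cancel_left1 one_S real_sqrt_abs2 real_sqrt_one uminus_S)
  then show ?thesis
    using w_mult[of "-1" x] assms by simp
qed

lemma w_diff_commute: "x \<in> S \<Longrightarrow> y \<in> S \<Longrightarrow> w (x - y) = w (y - x)"
  using w_uminus[of "x - y"] by simp

lemma w_triangle: "x \<in> S \<Longrightarrow> y \<in> S \<Longrightarrow> z \<in> S \<Longrightarrow> w (x - z) \<le> max (w (x - y)) (w (y - z))"
  using w_add[of "x - y" "y - z"] by simp

lemma abs_w_diff: assumes "x \<in> S" "y \<in> S" shows "\<bar>w x - w y\<bar> \<le> w (x - y)"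
proof -
  have "w x \<le> max (w (x - y)) (w y)" "w y \<le> max (w (x - y)) (w x)"
    using w_add[of "x - y" y] w_add[of "y - x" x] assms w_diff_commute[of x y] by auto
  then show ?thesis
    using w_nonneg[of x] w_nonneg[of y] w_nonneg[of "x - y"] assms by (auto simp: max_def split: if_splits)
qed

definition CS :: "(nat \<Rightarrow> 'f) set" where
  "CS = {X. range X \<subseteq> S \<and> (\<forall>e>0. \<exists>N. \<forall>m\<ge>N. \<forall>n\<ge>N. w (X m - X n) < e)}"

definition null_related :: "(nat \<Rightarrow> 'f) \<Rightarrow> (nat \<Rightarrow> 'f) \<Rightarrow> bool" (infix "\<simeq>" 50) where
  "X \<simeq> Y \<longleftrightarrow> (\<lambda>n. w (X n - Y n)) \<longlonglongrightarrow> 0"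

lemma CS_S [simp]: "X \<in> CS \<Longrightarrow> X n \<in> S"
  by (auto simp: CS_def)

lemma CS_E:
  assumes "X \<in> CS" "e > 0"
  obtains N where "\<And>m n. m \<ge> N \<Longrightarrow> n \<ge> N \<Longrightarrow> w (X m - X n) < e"
proof -
  have "\<exists>N. \<forall>m\<ge>N. \<forall>n\<ge>N. w (X m - X n) < e"
    using assms by (simp add: CS_def)
  then show ?thesis using that by blast
qed

lemma CS_const [simp]: "u \<in> S \<Longrightarrow> (\<lambda>_. u) \<in> CS"
  by (auto simp: CS_def)

lemma CS_convergent: assumes "X \<in> CS" shows "convergent (\<lambda>n. w (X n))"
proof (rule Cauchy_convergent, rule metric_CauchyI)
  fix e :: real assume "0 < e"
  then obtain N where N: "\<And>m n. m \<ge> N \<Longrightarrow> n \<ge> N \<Longrightarrow> w (X m - X n) < e"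
    using CS_E[OF assms] by metis
  have "dist (w (X m)) (w (X n)) < e" if "m \<ge> N" "n \<ge> N" for m n
    using N[OF that] abs_w_diff[of "X m" "X n"] assms by (simp add: dist_real_def)
  then show "\<exists>M. \<forall>m\<ge>M. \<forall>n\<ge>M. dist (w (X m)) (w (X n)) < e"
    by blast
qed

lemma CS_bounded: assumes "X \<in> CS" obtains B where "B > 0" "\<And>n. w (X n) \<le> B"
proof -
  obtain B where "B > 0" "\<And>n. norm (w (X n)) \<le> B"
    using convergent_imp_Bseq[OF CS_convergent[OF assms]] by (auto simp: Bseq_def)
  then show ?thesis by (intro that) (auto simp: abs_le_iff)
qed

lemma CS_add [simp]: assumes "X \<in> CS" "Y \<in> CS" shows "(\<lambda>n. X n + Y n) \<in> CS"
proof -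
  have "\<exists>N. \<forall>m\<ge>N. \<forall>n\<ge>N. w (X m + Y m - (X n + Y n)) < e" if e: "e > 0" for e
  proof -
    obtain N M where N: "\<And>m n. m \<ge> N \<Longrightarrow> n \<ge> N \<Longrightarrow> w (X m - X n) < e"
      and M: "\<And>m n. m \<ge> M \<Longrightarrow> n \<ge> M \<Longrightarrow> w (Y m - Y n) < e"
      using CS_E[OF assms(1) e] CS_E[OF assms(2) e] by metis
    have "w (X m + Y m - (X n + Y n)) < e" if "m \<ge> max M N" "n \<ge> max M N" for m n
      using w_add[of "X m - X n" "Y m - Y n"] N[of m n] M[of m n] that assms
      by (auto simp: algebra_simps)
    then show ?thesis by blast
  qed
  then show ?thesis using assms by (auto simp: CS_def)
qed

lemma CS_uminus [simp]: assumes "X \<in> CS" shows "(\<lambda>n. - X n) \<in> CS"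
proof -
  have "w (- X m - - X n) = w (X m - X n)" for m n
    using w_diff_commute[of "X m" "X n"] assms by simp
  then show ?thesis using assms by (auto simp: CS_def)
qed

lemma CS_diff [simp]: "X \<in> CS \<Longrightarrow> Y \<in> CS \<Longrightarrow> (\<lambda>n. X n - Y n) \<in> CS"
  using CS_add[of X "\<lambda>n. - Y n"] by simp

lemma w_mult_diff:
  assumes "x \<in> S" "y \<in> S" "x' \<in> S" "y' \<in> S"
  shows "w (x * y - x' * y') \<le> max (w (x - x') * w y) (w x' * w (y - y'))"
proof -
  have "x * y - x' * y' = (x - x') * y + x' * (y - y')" by (simp add: algebra_simps)
  then show ?thesis
    using w_add[of "(x - x') * y" "x' * (y - y')"] assms by (simp add: w_mult)
qed

lemma CS_mult [simp]: assumes "X \<in> CS" "Y \<in> CS" shows "(\<lambda>n. X n * Y n) \<in> CS"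
proof -
  obtain B C where B: "B > 0" "\<And>n. w (X n) \<le> B" and C: "C > 0" "\<And>n. w (Y n) \<le> C"
    using CS_bounded assms by metis
  have "\<exists>N. \<forall>m\<ge>N. \<forall>n\<ge>N. w (X m * Y m - X n * Y n) < e" if e: "e > 0" for e
  proof -
    obtain N M where N: "\<And>m n. m \<ge> N \<Longrightarrow> n \<ge> N \<Longrightarrow> w (X m - X n) < e / C"
      and M: "\<And>m n. m \<ge> M \<Longrightarrow> n \<ge> M \<Longrightarrow> w (Y m - Y n) < e / B"
      using CS_E[OF assms(1), of "e / C"] CS_E[OF assms(2), of "e / B"] e B C by (metis divide_pos_pos)
    have "w (X m * Y m - X n * Y n) < e" if "m \<ge> max M N" "n \<ge> max M N" for m n
    proof -
      have "w (X m - X n) * w (Y m) \<le> w (X m - X n) * C"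
        using C assms w_nonneg[of "X m - X n"] by (simp add: mult_left_mono)
      also have "\<dots> < e" using N[of m n] that C by (simp add: field_simps)
      finally have 1: "w (X m - X n) * w (Y m) < e" .
      have "w (X n) * w (Y m - Y n) \<le> B * w (Y m - Y n)"
        using B assms w_nonneg[of "Y m - Y n"] by (simp add: mult_right_mono)
      also have "\<dots> < e" using M[of m n] that B by (simp add: field_simps)
      finally show ?thesis
        using 1 w_mult_diff[of "X m" "Y m" "X n" "Y n"] assms by simp
    qed
    then show ?thesis by blast
  qed
  then show ?thesis using assms by (auto simp: CS_def)
qed

lemma null_refl [simp]: "X \<simeq> X"
  by (simp add: null_related_def)

lemma null_sym: "X \<in> CS \<Longrightarrow> Y \<in> CS \<Longrightarrow> X \<simeq> Y \<Longrightarrow> Y \<simeq> X"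
  unfolding null_related_def by (subst w_diff_commute) auto

lemma tendsto_0_max: "f \<longlonglongrightarrow> (0::real) \<Longrightarrow> g \<longlonglongrightarrow> 0 \<Longrightarrow> (\<lambda>n. max (f n) (g n)) \<longlonglongrightarrow> 0"
  using tendsto_max[of f 0 _ g 0] by simp

lemma w_null_bound:
  assumes "\<And>n. X n \<in> S" "\<And>n. w (X n) \<le> f n" "f \<longlonglongrightarrow> 0"
  shows "(\<lambda>n. w (X n)) \<longlonglongrightarrow> 0"
  by (rule tendsto_sandwich[OF _ _ tendsto_const assms(3)]) (auto simp: assms w_nonneg)

lemma null_trans:
  assumes "X \<in> CS" "Y \<in> CS" "Z \<in> CS" "X \<simeq> Y" "Y \<simeq> Z" shows "X \<simeq> Z"
  unfolding null_related_def
  by (rule w_null_bound[OF _ w_triangle tendsto_0_max[OF assms(4,5)[unfolded null_related_def]]])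
     (use assms in auto)

lemma null_add:
  assumes "X \<in> CS" "Y \<in> CS" "X' \<in> CS" "Y' \<in> CS" "X \<simeq> X'" "Y \<simeq> Y'"
  shows "(\<lambda>n. X n + Y n) \<simeq> (\<lambda>n. X' n + Y' n)"
  unfolding null_related_def
proof (rule w_null_bound[OF _ _ tendsto_0_max[OF assms(5,6)[unfolded null_related_def]]])
  fix n show "w (X n + Y n - (X' n + Y' n)) \<le> max (w (X n - X' n)) (w (Y n - Y' n))"
    using w_add[of "X n - X' n" "Y n - Y' n"] assms by (simp add: algebra_simps)
qed (use assms in auto)

lemma null_mult:
  assumes "X \<in> CS" "Y \<in> CS" "X' \<in> CS" "Y' \<in> CS" "X \<simeq> X'" "Y \<simeq> Y'"
  shows "(\<lambda>n. X n * Y n) \<simeq> (\<lambda>n. X' n * Y' n)"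
  unfolding null_related_def
proof (rule w_null_bound)
  have "(\<lambda>n. w (X n - X' n) * w (Y n)) \<longlonglongrightarrow> 0"
    using tendsto_mult[OF assms(5)[unfolded null_related_def] convergent_LIMSEQ_iff[THEN iffD1, OF CS_convergent[OF assms(2)]]] by simp
  moreover have "(\<lambda>n. w (X' n) * w (Y n - Y' n)) \<longlonglongrightarrow> 0"
    using tendsto_mult[OF convergent_LIMSEQ_iff[THEN iffD1, OF CS_convergent[OF assms(3)]] assms(6)[unfolded null_related_def]] by simp
  ultimately show "(\<lambda>n. max (w (X n - X' n) * w (Y n)) (w (X' n) * w (Y n - Y' n))) \<longlonglongrightarrow> 0"
    by (rule tendsto_0_max)
qed (use assms w_mult_diff in auto)

text \<open>The elements of the completion have to be reals: a class of Cauchy sequences is coded by the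
  real number attached to a chosen representative.\<close>

definition code :: "(nat \<Rightarrow> 'f) \<Rightarrow> real" where
  "code = (SOME c. inj_on c {X. range X \<subseteq> S})"

definition cls :: "(nat \<Rightarrow> 'f) \<Rightarrow> real" where
  "cls X = code (SOME Y. Y \<in> CS \<and> X \<simeq> Y)"

definition rep :: "real \<Rightarrow> nat \<Rightarrow> 'f" where
  "rep x = (SOME X. X \<in> CS \<and> cls X = x)"

lemma cls_eq_iff: assumes "X \<in> CS" "Y \<in> CS" shows "cls X = cls Y \<longleftrightarrow> X \<simeq> Y"
proof
  define rX where "rX = (SOME Z. Z \<in> CS \<and> X \<simeq> Z)"
  define rY where "rY = (SOME Z. Z \<in> CS \<and> Y \<simeq> Z)"
  have rX: "rX \<in> CS" "X \<simeq> rX"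
    using someI[of "\<lambda>Z. Z \<in> CS \<and> X \<simeq> Z" X] assms by (auto simp: rX_def)
  have rY: "rY \<in> CS" "Y \<simeq> rY"
    using someI[of "\<lambda>Z. Z \<in> CS \<and> Y \<simeq> Z" Y] assms by (auto simp: rY_def)
  have "inj_on code {X. range X \<subseteq> S}"
    unfolding code_def using ex_inj_on_sequences_into_real[OF countable_S] by (rule someI_ex)
  moreover assume "cls X = cls Y"
  then have "code rX = code rY"
    by (simp add: cls_def rX_def rY_def)
  moreover have "rX \<in> {X. range X \<subseteq> S}" "rY \<in> {X. range X \<subseteq> S}"
    using rX rY by (auto simp: CS_def)
  ultimately have "rX = rY"
    by (auto dest: inj_onD)
  then show "X \<simeq> Y"
    using rX rY assms null_trans null_sym by metis
next
  assume "X \<simeq> Y"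
  \<comment> \<open>Both classes apply \<open>SOME\<close> to the same predicate, so the chosen
    representatives coincide.\<close>
  then have "(\<lambda>Z. Z \<in> CS \<and> X \<simeq> Z) = (\<lambda>Z. Z \<in> CS \<and> Y \<simeq> Z)"
    using assms null_trans null_sym by blast
  then show "cls X = cls Y" by (simp add: cls_def)
qed

lemma rep: assumes "x \<in> cls ` CS" shows "rep x \<in> CS" "cls (rep x) = x"
proof -
  have "\<exists>X. X \<in> CS \<and> cls X = x" using assms by blast
  from someI_ex[OF this] show "rep x \<in> CS" "cls (rep x) = x" by (auto simp: rep_def)
qed

lemma rep_cls: "X \<in> CS \<Longrightarrow> rep (cls X) \<in> CS \<and> rep (cls X) \<simeq> X"
  using rep[of "cls X"] cls_eq_iff[of "rep (cls X)" X] by auto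

definition K :: "real ring" where
  "K = \<lparr> carrier = cls ` CS,
     monoid.mult = (\<lambda>x y. cls (\<lambda>n. rep x n * rep y n)), one = cls (\<lambda>_. 1),
     zero = cls (\<lambda>_. 0), add = (\<lambda>x y. cls (\<lambda>n. rep x n + rep y n)) \<rparr>"

definition v :: "real \<Rightarrow> real" where
  "v x = lim (\<lambda>n. w (rep x n))"

lemma K_mult: assumes "X \<in> CS" "Y \<in> CS" shows "cls X \<otimes>\<^bsub>K\<^esub> cls Y = cls (\<lambda>n. X n * Y n)"
proof -
  note r = rep_cls[OF assms(1)] rep_cls[OF assms(2)]
  have "(\<lambda>n. rep (cls X) n * rep (cls Y) n) \<simeq> (\<lambda>n. X n * Y n)"
    by (rule null_mult) (use assms r in auto)
  then show ?thesis
    using assms r by (simp add: K_def cls_eq_iff)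
qed

lemma K_add: assumes "X \<in> CS" "Y \<in> CS" shows "cls X \<oplus>\<^bsub>K\<^esub> cls Y = cls (\<lambda>n. X n + Y n)"
proof -
  note r = rep_cls[OF assms(1)] rep_cls[OF assms(2)]
  have "(\<lambda>n. rep (cls X) n + rep (cls Y) n) \<simeq> (\<lambda>n. X n + Y n)"
    by (rule null_add) (use assms r in auto)
  then show ?thesis
    using assms r by (simp add: K_def cls_eq_iff)
qed

lemma K_carrier: "carrier K = cls ` CS" and K_one: "\<one>\<^bsub>K\<^esub> = cls (\<lambda>_. 1)" and K_zero: "\<zero>\<^bsub>K\<^esub> = cls (\<lambda>_. 0)"
  by (simp_all add: K_def)

lemma w_tendsto_v: assumes "X \<in> CS" shows "(\<lambda>n. w (X n)) \<longlonglongrightarrow> v (cls X)"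
proof -
  have r: "rep (cls X) \<in> CS" "rep (cls X) \<simeq> X" using rep_cls[OF assms] by auto
  have "X \<simeq> rep (cls X)"
    using null_sym r assms by blast
  then have "(\<lambda>n. w (X n) - w (rep (cls X) n)) \<longlonglongrightarrow> 0"
    unfolding null_related_def
    by (rule tendsto_0_le[where K = 1]) (simp add: abs_w_diff w_nonneg r assms)
  moreover have "(\<lambda>n. w (rep (cls X) n)) \<longlonglongrightarrow> v (cls X)"
    unfolding v_def using CS_convergent[OF r(1)] by (simp add: convergent_LIMSEQ_iff)
  ultimately have "(\<lambda>n. (w (X n) - w (rep (cls X) n)) + w (rep (cls X) n)) \<longlonglongrightarrow> 0 + v (cls X)"
    by (rule tendsto_add)
  then show ?thesis by simp
qed

lemma cring_K: "cring K"
proof (rule cringI)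
  show "abelian_group K"
  proof (rule abelian_groupI)
    fix x assume "x \<in> carrier K"
    then obtain X where X: "X \<in> CS" "x = cls X" by (auto simp: K_carrier)
    then show "\<exists>y\<in>carrier K. y \<oplus>\<^bsub>K\<^esub> x = \<zero>\<^bsub>K\<^esub>"
      by (intro bexI[of _ "cls (\<lambda>n. - X n)"]) (auto simp: K_add K_zero K_carrier)
  qed (auto simp: K_carrier K_add K_zero add_ac)
  show "comm_monoid K"
    by (rule comm_monoidI) (auto simp: K_carrier K_mult K_one mult_ac)
qed (auto simp: K_carrier K_mult K_add algebra_simps)

sublocale K: cring K by (rule cring_K)

lemma K_uminus: assumes "X \<in> CS" shows "\<ominus>\<^bsub>K\<^esub> cls X = cls (\<lambda>n. - X n)"
  by (rule K.minus_equality) (use assms in \<open>auto simp: K_add K_zero K_carrier\<close>)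

lemma K_minus: "X \<in> CS \<Longrightarrow> Y \<in> CS \<Longrightarrow> cls X \<ominus>\<^bsub>K\<^esub> cls Y = cls (\<lambda>n. X n - Y n)"
  by (simp add: a_minus_def K_uminus K_add)

lemma v_nonneg: "x \<in> carrier K \<Longrightarrow> 0 \<le> v x"
  by (auto simp: K_carrier intro!: LIMSEQ_le_const[OF w_tendsto_v] w_nonneg)

lemma v_eq_0_iff: assumes "x \<in> carrier K" shows "v x = 0 \<longleftrightarrow> x = \<zero>\<^bsub>K\<^esub>"
proof -
  obtain X where X: "X \<in> CS" "x = cls X" using assms by (auto simp: K_carrier)
  have "x = \<zero>\<^bsub>K\<^esub> \<longleftrightarrow> (\<lambda>n. w (X n)) \<longlonglongrightarrow> 0"
    using X by (simp add: K_zero cls_eq_iff null_related_def)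
  then show ?thesis
    using w_tendsto_v[OF X(1)] X(2) by (auto dest: LIMSEQ_unique)
qed

lemma v_mult: "x \<in> carrier K \<Longrightarrow> y \<in> carrier K \<Longrightarrow> v (x \<otimes>\<^bsub>K\<^esub> y) = v x * v y"
proof (clarsimp simp: K_carrier K_mult)
  fix X Y assume X: "X \<in> CS" and Y: "Y \<in> CS"
  have "(\<lambda>n. w (X n * Y n)) \<longlonglongrightarrow> v (cls X) * v (cls Y)"
    using tendsto_mult[OF w_tendsto_v[OF X] w_tendsto_v[OF Y]] X Y by (simp add: w_mult)
  then show "v (cls (\<lambda>n. X n * Y n)) = v (cls X) * v (cls Y)"
    by (rule LIMSEQ_unique[OF w_tendsto_v[OF CS_mult[OF X Y]]])
qed

lemma v_add: "x \<in> carrier K \<Longrightarrow> y \<in> carrier K \<Longrightarrow> v (x \<oplus>\<^bsub>K\<^esub> y) \<le> max (v x) (v y)"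
proof (clarsimp simp only: K_carrier K_add)
  fix X Y assume X: "X \<in> CS" and Y: "Y \<in> CS"
  have "(\<lambda>n. max (w (X n)) (w (Y n))) \<longlonglongrightarrow> max (v (cls X)) (v (cls Y))"
    by (intro tendsto_max w_tendsto_v X Y)
  then show "v (cls (\<lambda>n. X n + Y n)) \<le> max (v (cls X)) (v (cls Y))"
    by (rule LIMSEQ_le[OF w_tendsto_v[OF CS_add[OF X Y]]]) (use X Y w_add in auto)
qed

lemma v_uminus: "x \<in> carrier K \<Longrightarrow> v (\<ominus>\<^bsub>K\<^esub> x) = v x"
proof (clarsimp simp: K_carrier K_uminus)
  fix X assume X: "X \<in> CS"
  have "(\<lambda>n. w (- X n)) \<longlonglongrightarrow> v (cls X)" using w_tendsto_v[OF X] X by (simp add: w_uminus)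
  then show "v (cls (\<lambda>n. - X n)) = v (cls X)"
    by (rule LIMSEQ_unique[OF w_tendsto_v[OF CS_uminus[OF X]]])
qed

text \<open>The value of a non-zero class is a positive limit, so the terms stay away from the
  kernel from some index on and can be inverted termwise.\<close>

lemma field_K: "field K"
proof (rule K.cring_fieldI, rule Set.set_eqI, rule iffI)
  have ne: "\<one>\<^bsub>K\<^esub> \<noteq> \<zero>\<^bsub>K\<^esub>"
    by (simp add: K_one K_zero cls_eq_iff null_related_def LIMSEQ_const_iff)
  fix x assume "x \<in> Units K"
  then show "x \<in> carrier K - {\<zero>\<^bsub>K\<^esub>}"
    using ne by (auto simp: Units_def)
next
  fix x assume x: "x \<in> carrier K - {\<zero>\<^bsub>K\<^esub>}"
  then obtain X where X: "X \<in> CS" "x = cls X" by (auto simp: K_carrier)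
  define c where "c = v x / 2"
  have c: "c > 0" and lim: "(\<lambda>n. w (X n)) \<longlonglongrightarrow> v x"
    using x v_nonneg[of x] v_eq_0_iff[of x] w_tendsto_v[OF X(1)] X(2) by (auto simp: c_def)
  have "\<forall>\<^sub>F n in sequentially. c < w (X n)"
    using order_tendstoD(1)[OF lim, of c] c by (simp add: c_def)
  then obtain N where N: "\<And>n. n \<ge> N \<Longrightarrow> c < w (X n)"
    by (auto simp: eventually_sequentially)
  \<comment> \<open>Before \<open>N\<close> the inverse might leave \<open>S\<close>; the value 0
    there does not affect the class.\<close>
  define Y where "Y n = (if n \<ge> N then inverse (X n) else 0)" for n
  have YS: "Y n \<in> S" for n
    using inverse_S[of "X n"] N[of n] X c by (auto simp: Y_def)
  have "Y \<in> CS"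
    unfolding CS_def
  proof (safe)
    fix e :: real assume e: "e > 0"
    then obtain M where M: "\<And>m n. m \<ge> M \<Longrightarrow> n \<ge> M \<Longrightarrow> w (X m - X n) < e * (c * c)"
      using CS_E[OF X(1), of "e * (c * c)"] c by (metis mult_pos_pos)
    have "w (Y m - Y n) < e" if mn: "m \<ge> max M N" "n \<ge> max M N" for m n
    proof -
      have wm: "c < w (X m)" and wn: "c < w (X n)" using N mn by auto
      then have "X m \<noteq> 0" "X n \<noteq> 0" using c by auto
      then have "(Y m - Y n) * (X m * X n) = X n - X m"
        using mn by (simp add: Y_def field_simps)
      then have eq: "w (Y m - Y n) * (w (X m) * w (X n)) = w (X m - X n)"
        using w_mult[of "Y m - Y n" "X m * X n"] w_mult[of "X m" "X n"] X YS
          w_diff_commute[of "X m" "X n"] by simp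
      have "w (Y m - Y n) * (c * c) \<le> w (Y m - Y n) * (w (X m) * w (X n))"
        using wm wn c YS w_nonneg[of "Y m - Y n"] by (intro mult_left_mono mult_mono) auto
      also have "\<dots> < e * (c * c)" using eq M[of m n] mn by simp
      finally show ?thesis using c by simp
    qed
    then show "\<exists>N. \<forall>m\<ge>N. \<forall>n\<ge>N. w (Y m - Y n) < e" by blast
  qed (use YS in auto)
  moreover have "(\<lambda>n. Y n * X n) \<simeq> (\<lambda>_. 1)"
    unfolding null_related_def
  proof (rule tendsto_eventually)
    have "w (Y n * X n - 1) = 0" if "n \<ge> N" for n
      using N[OF that] c that by (cases "X n = 0") (auto simp: Y_def)
    then show "\<forall>\<^sub>F n in sequentially. w (Y n * X n - 1) = 0"
      by (auto simp: eventually_sequentially)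
  qed
  ultimately have "cls Y \<otimes>\<^bsub>K\<^esub> x = \<one>\<^bsub>K\<^esub>" "cls Y \<in> carrier K"
    using X by (auto simp: K_mult K_one cls_eq_iff K_carrier)
  then show "x \<in> Units K"
    using x K.m_comm[of x "cls Y"] by (auto simp: Units_def)
qed

lemma K_const_dense:
  assumes "x \<in> carrier K" "e > 0" shows "\<exists>u\<in>S. v (x \<ominus>\<^bsub>K\<^esub> cls (\<lambda>_. u)) < e"
proof -
  obtain X where X: "X \<in> CS" "x = cls X" using assms by (auto simp: K_carrier)
  obtain N where N: "\<And>m n. m \<ge> N \<Longrightarrow> n \<ge> N \<Longrightarrow> w (X m - X n) < e / 2"
    using CS_E[OF X(1), of "e / 2"] assms(2) by (metis half_gt_zero)
  have "(\<lambda>n. w (X n - X N)) \<longlonglongrightarrow> v (x \<ominus>\<^bsub>K\<^esub> cls (\<lambda>_. X N))"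
    using w_tendsto_v[of "\<lambda>n. X n - X N"] X by (simp add: K_minus)
  then have "v (x \<ominus>\<^bsub>K\<^esub> cls (\<lambda>_. X N)) \<le> e / 2"
    by (rule LIMSEQ_le_const2) (use N in \<open>auto intro: less_imp_le\<close>)
  then show ?thesis using X assms by (intro bexI[of _ "X N"]) auto
qed

lemma v_const: "u \<in> S \<Longrightarrow> v (cls (\<lambda>_. u)) = w u"
  using w_tendsto_v[of "\<lambda>_. u"] by (simp add: LIMSEQ_const_iff)

text \<open>Each \<open>X n\<close> is approximated within \<open>1 / (n + 1)\<close> by the class
  of a constant \<open>u n\<close>. The sequence \<open>u\<close> is itself Cauchy in
  \<open>S\<close>, and its class is the limit.\<close>

lemma K_complete:
  assumes XK: "\<And>n. X n \<in> carrier K"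
    and cauchy: "\<And>e. e > 0 \<Longrightarrow> \<exists>N. \<forall>m\<ge>N. \<forall>n\<ge>N. v (X m \<ominus>\<^bsub>K\<^esub> X n) < e"
  shows "\<exists>L\<in>carrier K. (\<lambda>n. v (X n \<ominus>\<^bsub>K\<^esub> L)) \<longlonglongrightarrow> 0"
proof -
  have "\<exists>u. u \<in> S \<and> v (X n \<ominus>\<^bsub>K\<^esub> cls (\<lambda>_. u)) < 1 / real (Suc n)" for n
    using K_const_dense[OF XK, of "1 / real (Suc n)"] by auto
  then obtain u where u: "\<And>n. u n \<in> S" "\<And>n. v (X n \<ominus>\<^bsub>K\<^esub> cls (\<lambda>_. u n)) < 1 / real (Suc n)"
    by metis
  define U where "U n = cls (\<lambda>_. u n)" for n
  have UK [simp]: "U n \<in> carrier K" for n using u by (auto simp: U_def K_carrier)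
  have vU: "v (U m \<ominus>\<^bsub>K\<^esub> U n) = w (u m - u n)" for m n
    using u by (simp add: U_def K_minus v_const)
  have tri: "v (x \<ominus>\<^bsub>K\<^esub> z) \<le> max (v (x \<ominus>\<^bsub>K\<^esub> y)) (v (y \<ominus>\<^bsub>K\<^esub> z))"
    if "x \<in> carrier K" "y \<in> carrier K" "z \<in> carrier K" for x y z
  proof -
    have "x \<ominus>\<^bsub>K\<^esub> z = (x \<ominus>\<^bsub>K\<^esub> y) \<oplus>\<^bsub>K\<^esub> (y \<ominus>\<^bsub>K\<^esub> z)"
      using that by (simp add: a_minus_def K.a_assoc K.r_neg1)
    then show ?thesis using v_add[of "x \<ominus>\<^bsub>K\<^esub> y" "y \<ominus>\<^bsub>K\<^esub> z"] that by simp
  qed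
  have sym: "v (x \<ominus>\<^bsub>K\<^esub> y) = v (y \<ominus>\<^bsub>K\<^esub> x)" if "x \<in> carrier K" "y \<in> carrier K" for x y
    using v_uminus[of "x \<ominus>\<^bsub>K\<^esub> y"] that by (simp add: a_minus_def K.minus_add K.a_comm)
  have uCS: "u \<in> CS"
    unfolding CS_def
  proof safe
    fix e :: real assume e: "e > 0"
    obtain N where N: "\<And>m n. m \<ge> N \<Longrightarrow> n \<ge> N \<Longrightarrow> v (X m \<ominus>\<^bsub>K\<^esub> X n) < e" using cauchy[OF e] by blast
    obtain M where M: "1 / real (Suc M) < e" using e by (meson nat_approx_posE)
    have small: "v (X n \<ominus>\<^bsub>K\<^esub> U n) < e" if "n \<ge> M" for n
    proof -
      have "1 / real (Suc n) \<le> 1 / real (Suc M)" using that by (simp add: field_simps)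
      then show ?thesis using u(2)[of n] M by (simp add: U_def)
    qed
    have "w (u m - u n) < e" if "m \<ge> max M N" "n \<ge> max M N" for m n
      using tri[of "U m" "X m" "U n"] tri[of "X m" "X n" "U n"] small[of m] small[of n] N[of m n] that
        sym[of "U m" "X m"] XK vU[of m n] by auto
    then show "\<exists>N. \<forall>m\<ge>N. \<forall>n\<ge>N. w (u m - u n) < e" by blast
  qed (use u in auto)
  define L where "L = cls u"
  have L: "L \<in> carrier K" using uCS by (auto simp: L_def K_carrier)
  have lim1: "(\<lambda>n. v (X n \<ominus>\<^bsub>K\<^esub> U n)) \<longlonglongrightarrow> 0"
  proof (rule tendsto_sandwich[OF _ _ tendsto_const LIMSEQ_inverse_real_of_nat])
    show "\<forall>\<^sub>F n in sequentially. v (X n \<ominus>\<^bsub>K\<^esub> U n) \<le> inverse (real (Suc n))"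
      using u(2) by (auto simp: U_def inverse_eq_divide intro!: always_eventually less_imp_le)
    show "\<forall>\<^sub>F n in sequentially. 0 \<le> v (X n \<ominus>\<^bsub>K\<^esub> U n)"
      using XK by (auto intro!: always_eventually v_nonneg)
  qed
  have lim2: "(\<lambda>n. v (U n \<ominus>\<^bsub>K\<^esub> L)) \<longlonglongrightarrow> 0"
  proof (rule LIMSEQ_I)
    fix e :: real assume e: "e > 0"
    obtain N where N: "\<And>m n. m \<ge> N \<Longrightarrow> n \<ge> N \<Longrightarrow> w (u m - u n) < e / 2"
      using CS_E[OF uCS, of "e / 2"] e by (metis half_gt_zero)
    have "norm (v (U n \<ominus>\<^bsub>K\<^esub> L) - 0) < e" if "n \<ge> N" for n
    proof -
      have "(\<lambda>m. w (u n - u m)) \<longlonglongrightarrow> v (U n \<ominus>\<^bsub>K\<^esub> L)"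
        using w_tendsto_v[of "\<lambda>m. u n - u m"] uCS u by (simp add: U_def L_def K_minus)
      then have "v (U n \<ominus>\<^bsub>K\<^esub> L) \<le> e / 2"
        by (rule LIMSEQ_le_const2) (use N that in \<open>auto intro: less_imp_le\<close>)
      then show ?thesis using e L v_nonneg[of "U n \<ominus>\<^bsub>K\<^esub> L"] by simp
    qed
    then show "\<exists>no. \<forall>n\<ge>no. norm (v (U n \<ominus>\<^bsub>K\<^esub> L) - 0) < e" by blast
  qed
  have "(\<lambda>n. v (X n \<ominus>\<^bsub>K\<^esub> L)) \<longlonglongrightarrow> 0"
    by (rule tendsto_sandwich[OF _ _ tendsto_const tendsto_0_max[OF lim1 lim2]])
       (use XK L tri in \<open>auto intro!: always_eventually v_nonneg\<close>)
  then show ?thesis using L by blast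
qed

lemma complete_valued_field_K: "complete_valued_field K v"
  unfolding complete_valued_field_def
  using field_K v_nonneg v_eq_0_iff v_mult K_complete
  by (auto intro: order_trans[OF v_add] simp: v_nonneg)

end


section \<open>Ultrametric seminorms and the completed residue field of a multiplicative one\<close>

definition um_seminorm :: "('p :: comm_ring_1 \<Rightarrow> real) \<Rightarrow> bool" where
  "um_seminorm w \<longleftrightarrow> (\<forall>f. 0 \<le> w f) \<and> w 0 = 0 \<and> w 1 \<le> 1 \<and> (\<forall>f. w (- f) = w f) \<and>
     (\<forall>f g. w (f + g) \<le> max (w f) (w g)) \<and> (\<forall>f g. w (f * g) \<le> w f * w g)"

lemma um_seminormD:
  assumes "um_seminorm w"
  shows "0 \<le> w f" "w 0 = 0" "w 1 \<le> 1" "w (- f) = w f" "w (f + g) \<le> max (w f) (w g)"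
    "w (f * g) \<le> w f * w g" "w (f - g) \<le> max (w f) (w g)"
  using assms[unfolded um_seminorm_def] by simp_all (metis diff_conv_add_uminus)

text \<open>Multiplicativity makes \<open>ker w\<close> prime, and the fractions with denominator
  outside it form the valued subring to be completed. The last property is the density of these
  fractions with denominators cleared, so that only values of \<open>\<phi>\<close> occur in
  it.\<close>

lemma ex_completion:
  fixes w :: "'p :: idom \<Rightarrow> real"
  assumes w: "um_seminorm w" and mult: "\<And>f g. w (f * g) = w f * w g" and w1: "w 1 = 1"
    and cnt: "countable (UNIV :: 'p set)"
  obtains K :: "real ring" and v :: "real \<Rightarrow> real" and \<phi> :: "'p \<Rightarrow> real" where
    "complete_valued_field K v"
    "\<And>x y. x \<in> carrier K \<Longrightarrow> y \<in> carrier K \<Longrightarrow> v (x \<oplus>\<^bsub>K\<^esub> y) \<le> max (v x) (v y)"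
    "\<And>f. \<phi> f \<in> carrier K" "\<phi> 1 = \<one>\<^bsub>K\<^esub>"
    "\<And>f g. \<phi> (f + g) = \<phi> f \<oplus>\<^bsub>K\<^esub> \<phi> g" "\<And>f g. \<phi> (f * g) = \<phi> f \<otimes>\<^bsub>K\<^esub> \<phi> g"
    "\<And>f. v (\<phi> f) = w f"
    "\<And>x e. x \<in> carrier K \<Longrightarrow> e > 0 \<Longrightarrow>
       \<exists>f g. w g \<noteq> 0 \<and> v (\<phi> g \<otimes>\<^bsub>K\<^esub> x \<ominus>\<^bsub>K\<^esub> \<phi> f) < e * w g"
proof -
  note wD = um_seminormD[OF w]
  define S where "S = {Fract f g | f g. w g \<noteq> 0}"
  \<comment> \<open>A fraction has many presentations; cross-multiplication and multiplicativity of
    \<open>w\<close> show below that the quotient does not depend on the one chosen.\<close>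
  define W where "W u = (SOME r. \<exists>f g. w g \<noteq> 0 \<and> u = Fract f g \<and> r = w f / w g)" for u
  have nz: "g \<noteq> 0" if "w g \<noteq> 0" for g
    using that wD(2) by auto
  have W: "W (Fract f g) = w f / w g" if g: "w g \<noteq> 0" for f g
  proof -
    have "\<exists>f' g'. w g' \<noteq> 0 \<and> Fract f g = Fract f' g' \<and> W (Fract f g) = w f' / w g'"
      unfolding W_def by (rule someI_ex) (use g in blast)
    then obtain f' g' where *: "w g' \<noteq> 0" "Fract f g = Fract f' g'" "W (Fract f g) = w f' / w g'"
      by blast
    then have "f * g' = f' * g" using g nz by (simp add: eq_fract)
    then have "w f * w g' = w f' * w g" by (metis mult)
    then show ?thesis unfolding *(3) using *(1) g by (simp add: frac_eq_eq)
  qed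
  interpret valued_subring S W
  proof
    have "S \<subseteq> range (\<lambda>(f, g). Fract f g)" by (auto simp: S_def)
    moreover have "countable (UNIV :: ('p \<times> 'p) set)"
      using cnt countable_SIGMA[of UNIV "\<lambda>_. UNIV"] by (simp add: UNIV_Times_UNIV[symmetric] del: UNIV_Times_UNIV)
    ultimately show "countable S" by (meson countable_image countable_subset)
    have "Fract f 1 \<in> S" for f using w1 by (force simp: S_def)
    then show "0 \<in> S" "1 \<in> S" "W 0 = 0" "W 1 = 1"
      using w1 wD(2) W[of 1] by (simp_all add: Zero_fract_def One_fract_def)
  next
    fix x y assume "x \<in> S" "y \<in> S"
    then obtain f g f' g' where x: "x = Fract f g" "w g \<noteq> 0" and y: "y = Fract f' g'" "w g' \<noteq> 0"
      by (auto simp: S_def)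
    have gg: "w (g * g') \<noteq> 0" using x y mult by simp
    have sum: "x + y = Fract (f * g' + f' * g) (g * g')" and prod: "x * y = Fract (f * f') (g * g')"
      using x y nz by auto
    show "x + y \<in> S" "x * y \<in> S" using gg by (auto simp: sum prod S_def)
    show "W (x * y) = W x * W y" unfolding prod using gg x y W by (simp add: mult)
    have "w (f * g' + f' * g) / w (g * g') \<le> max (w f * w g') (w f' * w g) / w (g * g')"
      using wD(5)[of "f * g'" "f' * g"] wD(1)[of "g * g'"] by (intro divide_right_mono) (auto simp: mult)
    also have "\<dots> = max (w f / w g) (w f' / w g')"
      using x y wD(1)[of g] wD(1)[of g'] by (simp add: mult max_def field_simps)
    finally show "W (x + y) \<le> max (W x) (W y)"
      unfolding sum using gg x y W by simp
  next
    fix x assume "x \<in> S"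
    then obtain f g where x: "x = Fract f g" "w g \<noteq> 0" by (auto simp: S_def)
    show "- x \<in> S" "0 \<le> W x" using x W wD by (auto simp: S_def)
    show "inverse x \<in> S" if "W x \<noteq> 0" using x W that by (auto simp: S_def)
  qed
  define \<phi> where "\<phi> f = cls (\<lambda>_. Fract f 1)" for f
  have FS [simp]: "Fract f 1 \<in> S" for f using w1 by (force simp: S_def)
  have v\<phi>: "v (\<phi> f) = w f" for f unfolding \<phi>_def using v_const[OF FS, of f] W[of 1 f] w1 by simp
  show thesis
  proof (rule that[OF complete_valued_field_K, of \<phi>])
    fix x and e :: real assume x: "x \<in> carrier K" and e: "e > 0"
    obtain f g where u: "w g \<noteq> 0" "v (x \<ominus>\<^bsub>K\<^esub> cls (\<lambda>_. Fract f g)) < e"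
      using K_const_dense[OF x e] by (auto simp: S_def)
    have FgS [simp]: "Fract f g \<in> S" using u by (auto simp: S_def)
    have "\<phi> g \<otimes>\<^bsub>K\<^esub> cls (\<lambda>_. Fract f g) = \<phi> f"
    proof -
      have "Fract (g * f) g = Fract f 1"
        using nz[OF u(1)] by (simp add: eq_fract)
      then show ?thesis by (simp add: \<phi>_def K_mult)
    qed
    moreover have closed: "\<phi> g \<in> carrier K" "cls (\<lambda>_. Fract f g) \<in> carrier K"
      by (simp_all add: \<phi>_def K_carrier)
    ultimately have "\<phi> g \<otimes>\<^bsub>K\<^esub> x \<ominus>\<^bsub>K\<^esub> \<phi> f = \<phi> g \<otimes>\<^bsub>K\<^esub> (x \<ominus>\<^bsub>K\<^esub> cls (\<lambda>_. Fract f g))"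
      using x by (simp add: a_minus_def K.r_distr K.r_minus)
    then have "v (\<phi> g \<otimes>\<^bsub>K\<^esub> x \<ominus>\<^bsub>K\<^esub> \<phi> f) = w g * v (x \<ominus>\<^bsub>K\<^esub> cls (\<lambda>_. Fract f g))"
      using x closed v\<phi>[of g] by (simp add: v_mult)
    also have "\<dots> < e * w g"
      using u wD(1)[of g] by simp
    finally show "\<exists>f g. w g \<noteq> 0 \<and> v (\<phi> g \<otimes>\<^bsub>K\<^esub> x \<ominus>\<^bsub>K\<^esub> \<phi> f) < e * w g" using u by blast
  qed (auto simp: v\<phi> v_add, auto simp: \<phi>_def K_carrier K_one K_add K_mult One_fract_def)
qed

lemma countable_int_poly: "countable (UNIV :: int poly set)"
proof (rule countableI)
  show "inj (\<lambda>p :: int poly. to_nat (coeffs p))"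
    by (auto intro!: injI simp: coeffs_eq_iff)
qed

section \<open>Lowering ultrametric seminorms\<close>

lemma um_seminorm_sum:
  assumes w: "um_seminorm w" and "finite A" "0 \<le> M" "\<And>x. x \<in> A \<Longrightarrow> w (h x) \<le> M"
  shows "w (\<Sum>x\<in>A. h x) \<le> M"
  using assms(2,4)
proof (induction A rule: finite_induct)
  case (insert x A)
  then have "max (w (h x)) (w (\<Sum>x\<in>A. h x)) \<le> M" by simp
  then show ?case
    using um_seminormD(5)[OF w, of "h x" "\<Sum>x\<in>A. h x"] insert(1,2) by (simp add: order_trans)
qed (use um_seminormD[OF w] assms in auto)

lemma um_seminorm_power: assumes "um_seminorm w" shows "w (g ^ n) \<le> w g ^ n"
proof (induction n)
  case (Suc n)
  have "w (g * g ^ n) \<le> w g * w (g ^ n)" by (rule um_seminormD(6)[OF assms])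
  also have "\<dots> \<le> w g * w g ^ n"
    using Suc um_seminormD(1)[OF assms] by (intro mult_left_mono)
  finally show ?case by simp
qed (use um_seminormD(3)[OF assms] in simp)

lemma le_mult_if_le_mult_greater:
  fixes x y z :: real
  assumes "\<And>b c. x < b \<Longrightarrow> y < c \<Longrightarrow> z \<le> b * c"
  shows "z \<le> x * y"
proof (rule LIMSEQ_le_const)
  have "(\<lambda>n. (x + inverse (real (Suc n))) * (y + inverse (real (Suc n)))) \<longlonglongrightarrow> (x + 0) * (y + 0)"
    by (intro tendsto_intros LIMSEQ_inverse_real_of_nat)
  then show "(\<lambda>n. (x + inverse (real (Suc n))) * (y + inverse (real (Suc n)))) \<longlonglongrightarrow> x * y"
    by simp
  show "\<exists>N. \<forall>n\<ge>N. z \<le> (x + inverse (real (Suc n))) * (y + inverse (real (Suc n)))"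
    using assms by simp
qed

text \<open>Tailored to functions defined as infima, where a strict upper bound yields a witness.
  The axioms are asked with strict hypotheses and non-strict conclusions; letting the bounds
  decrease gives the actual inequalities.\<close>

lemma um_seminormI:
  fixes u :: "'p :: comm_ring_1 \<Rightarrow> real"
  assumes "\<And>f. 0 \<le> u f" "u 0 = 0" "u 1 \<le> 1"
    and "\<And>f c. u f < c \<Longrightarrow> u (- f) \<le> c"
    and "\<And>f g c. u f < c \<Longrightarrow> u g < c \<Longrightarrow> u (f + g) \<le> c"
    and "\<And>f g b c. u f < b \<Longrightarrow> u g < c \<Longrightarrow> u (f * g) \<le> b * c"
  shows "um_seminorm u"
  unfolding um_seminorm_def
proof (intro conjI allI)
  have le: "u (- f) \<le> u f" for f
    by (rule dense_ge) (rule assms(4))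
  show "u (- f) = u f" for f
    using le[of f] le[of "- f"] by simp
  show "u (f + g) \<le> max (u f) (u g)" for f g
    by (rule dense_ge) (rule assms(5), auto)
  show "u (f * g) \<le> u f * u g" for f g
    by (rule le_mult_if_le_mult_greater) (rule assms(6))
qed (use assms in auto)

text \<open>The largest seminorm below \<open>w\<close> whose value at \<open>g\<close> is at most \<open>d\<close>.\<close>

definition lowered :: "('p :: comm_ring_1 \<Rightarrow> real) \<Rightarrow> 'p \<Rightarrow> real \<Rightarrow> 'p \<Rightarrow> real" where
  "lowered w g d f = Inf {M. 0 \<le> M \<and> (\<exists>P. poly P g = f \<and> (\<forall>i. w (coeff P i) * d ^ i \<le> M))}"

context
  fixes w :: "'p :: comm_ring_1 \<Rightarrow> real" and g :: 'p and d :: real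
  assumes w: "um_seminorm w" and d: "d > 0"
begin

private lemma lowered_le:
  "0 \<le> M \<Longrightarrow> (\<And>i. w (coeff P i) * d ^ i \<le> M) \<Longrightarrow> lowered w g d (poly P g) \<le> M"
  unfolding lowered_def by (intro cInf_lower) (auto intro!: bdd_belowI[of _ 0])

lemma lowered_le_self: "lowered w g d f \<le> w f"
proof -
  have "w (coeff [:f:] i) * d ^ i \<le> w f" for i
    using um_seminormD[OF w] by (cases i) auto
  then show ?thesis using lowered_le[of "w f" "[:f:]"] um_seminormD(1)[OF w] by simp
qed

lemma lowered_lessE:
  assumes "lowered w g d f < c"
  obtains P where "poly P g = f" "\<And>i. w (coeff P i) * d ^ i < c"
proof -
  have "{M. 0 \<le> M \<and> (\<exists>P. poly P g = f \<and> (\<forall>i. w (coeff P i) * d ^ i \<le> M))} \<noteq> {}"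
  proof -
    have "w (coeff [:f:] i) * d ^ i \<le> w f" for i
      using um_seminormD[OF w] by (cases i) auto
    moreover have "poly [:f:] g = f" by simp
    ultimately show ?thesis using um_seminormD(1)[OF w] by blast
  qed
  from cInf_lessD[OF this assms[unfolded lowered_def]]
  obtain P M where "poly P g = f" "\<forall>i. w (coeff P i) * d ^ i \<le> M" "M < c" by blast
  then show ?thesis using that le_less_trans by blast
qed

lemma lowered_le_bound: "lowered w g d g \<le> d"
proof -
  have "w (coeff [:0, 1:] i) * d ^ i \<le> d" for i
  proof (cases "i = 1")
    case True
    then show ?thesis using um_seminormD(3)[OF w] d by simp
  next
    case False
    then have "coeff [:0, 1 :: 'p:] i = 0" by (auto simp: coeff_pCons split: nat.split)
    then show ?thesis using um_seminormD(2)[OF w] d by simp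
  qed
  then show ?thesis using lowered_le[of d "[:0, 1:]"] d by simp
qed

text \<open>\<open>lowered w g d\<close> is the quotient, under \<open>X \<mapsto> g\<close>, of the
  Gauss seminorm of radius \<open>d\<close> on polynomials in \<open>X\<close>. Sums and products of
  representing polynomials represent sums and products, with the required bounds on their
  coefficients.\<close>

lemma um_seminorm_lowered: "um_seminorm (lowered w g d)"
proof (rule um_seminormI)
  note wD = um_seminormD[OF w]
  show nonneg: "0 \<le> lowered w g d f" for f
  proof (rule ccontr)
    assume "\<not> 0 \<le> lowered w g d f"
    then obtain P where "\<And>i. w (coeff P i) * d ^ i < 0" using lowered_lessE by (metis not_le)
    then show False using wD(1) d by (metis linorder_not_le mult_nonneg_nonneg zero_le_power less_imp_le)
  qed
  show "lowered w g d 0 = 0" "lowered w g d 1 \<le> 1"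
    using lowered_le_self[of 0] lowered_le_self[of 1] nonneg[of 0] wD(2,3) by auto
  fix f h c assume f: "lowered w g d f < c"
  from lowered_lessE[OF this]
  obtain P where P: "poly P g = f" "\<And>i. w (coeff P i) * d ^ i < c" by blast
  have c: "c > 0" using f nonneg[of f] by simp
  show "lowered w g d (- f) \<le> c"
    using lowered_le[of c "- P"] P c wD(4) by (simp add: less_imp_le)
  show "lowered w g d (f + h) \<le> c" if "lowered w g d h < c"
  proof -
    obtain Q where Q: "poly Q g = h" "\<And>i. w (coeff Q i) * d ^ i < c"
      using lowered_lessE[OF \<open>lowered w g d h < c\<close>] by blast
    have "w (coeff (P + Q) i) * d ^ i \<le> c" for i
    proof -
      have "w (coeff (P + Q) i) * d ^ i \<le> max (w (coeff P i)) (w (coeff Q i)) * d ^ i"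
        using wD(5) d by (simp add: mult_right_mono)
      also have "\<dots> \<le> c" using P(2)[of i] Q(2)[of i] by (simp add: max_def)
      finally show ?thesis .
    qed
    then show ?thesis using lowered_le[of c "P + Q"] c P Q by simp
  qed
next
  note wD = um_seminormD[OF w]
  fix f h b c assume f: "lowered w g d f < b" and h: "lowered w g d h < c"
  obtain P where P: "poly P g = f" "\<And>i. w (coeff P i) * d ^ i < b" using lowered_lessE[OF f] by blast
  obtain Q where Q: "poly Q g = h" "\<And>i. w (coeff Q i) * d ^ i < c" using lowered_lessE[OF h] by blast
  have pos: "b > 0" "c > 0"
    using P(2)[of 0] Q(2)[of 0] wD(1)[of "coeff P 0"] wD(1)[of "coeff Q 0"] by auto
  have "w (coeff (P * Q) i) * d ^ i \<le> b * c" for i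
  proof -
    have "w (\<Sum>j\<le>i. coeff P j * coeff Q (i - j)) \<le> b * c / d ^ i"
    proof (rule um_seminorm_sum[OF w])
      fix j assume "j \<in> {..i}"
      then have dd: "d ^ i = d ^ j * d ^ (i - j)" by (simp flip: power_add)
      have "w (coeff P j * coeff Q (i - j)) * d ^ i \<le> w (coeff P j) * w (coeff Q (i - j)) * d ^ i"
        using wD(6) d by (simp add: mult_right_mono)
      also have "\<dots> = (w (coeff P j) * d ^ j) * (w (coeff Q (i - j)) * d ^ (i - j))"
        by (simp add: dd)
      also have "\<dots> \<le> b * c"
        using P(2)[of j] Q(2)[of "i - j"] pos wD(1) d by (intro mult_mono) (auto intro: less_imp_le)
      finally show "w (coeff P j * coeff Q (i - j)) \<le> b * c / d ^ i"
        using d by (simp add: field_simps)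
    qed (use pos d in auto)
    then show ?thesis using d by (simp add: coeff_mult field_simps)
  qed
  then show "lowered w g d (f * h) \<le> b * c"
    using lowered_le[of "b * c" "P * Q"] pos P Q by simp
qed

end

text \<open>The largest seminorm below \<open>w\<close> for which multiplication by \<open>g\<close> scales by \<open>w g\<close>.\<close>

definition stabilized :: "('p :: comm_ring_1 \<Rightarrow> real) \<Rightarrow> 'p \<Rightarrow> 'p \<Rightarrow> real" where
  "stabilized w g f = (INF n. w (g ^ n * f) / w g ^ n)"

context
  fixes w :: "'p :: comm_ring_1 \<Rightarrow> real" and g :: 'p
  assumes w: "um_seminorm w" and g: "w g > 0" and pow: "\<And>n. w (g ^ n) = w g ^ n"
begin

lemma stabilized_le: "stabilized w g f \<le> w (g ^ n * f) / w g ^ n"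
  unfolding stabilized_def
  by (rule cINF_lower[OF bdd_belowI[of _ 0]]) (use um_seminormD(1)[OF w] in auto)

lemma stabilized_lessE:
  assumes "stabilized w g f < c"
  obtains n where "w (g ^ n * f) < c * w g ^ n"
proof -
  from cInf_lessD[OF _ assms[unfolded stabilized_def]]
  obtain n where "w (g ^ n * f) / w g ^ n < c" by auto
  then show ?thesis using that[of n] g by (simp add: field_simps)
qed

text \<open>As \<open>w\<close> is multiplicative on powers of \<open>g\<close>, a further power of
  \<open>g\<close> cannot increase \<open>w (g ^ n * f) / w g ^ n\<close>. Hence several elements
  can be given a common exponent.\<close>

lemma stabilized_less_mono:
  assumes "w (g ^ n * f) < c * w g ^ n" "n \<le> m"
  shows "w (g ^ m * f) < c * w g ^ m"
proof -
  have "w (g ^ (m - n) * (g ^ n * f)) \<le> w g ^ (m - n) * w (g ^ n * f)"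
    using um_seminormD(6)[OF w, of "g ^ (m - n)" "g ^ n * f"] pow by simp
  also have "\<dots> < w g ^ (m - n) * (c * w g ^ n)"
    using assms g by simp
  also have "w g ^ (m - n) * (c * w g ^ n) = c * (w g ^ (m - n) * w g ^ n)"
    by simp
  also have "w g ^ (m - n) * w g ^ n = w g ^ m"
    using assms(2) by (simp flip: power_add)
  also have "g ^ (m - n) * (g ^ n * f) = g ^ m * f"
    using assms(2) by (simp flip: power_add mult.assoc)
  finally show ?thesis .
qed

lemma um_seminorm_stabilized: "um_seminorm (stabilized w g)"
proof (rule um_seminormI)
  note wD = um_seminormD[OF w]
  show nonneg: "0 \<le> stabilized w g f" for f
    unfolding stabilized_def by (rule cINF_greatest) (use wD(1) in auto)
  show "stabilized w g 0 = 0" "stabilized w g 1 \<le> 1"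
    using stabilized_le[of 0 0] stabilized_le[of 1 0] nonneg[of 0] wD(2,3) by auto
  fix f h c assume f: "stabilized w g f < c"
  from stabilized_lessE[OF this] obtain n where n: "w (g ^ n * f) < c * w g ^ n" .
  have "w (g ^ n * - f) / w g ^ n \<le> c"
    using n g wD(4)[of "g ^ n * f"] by (simp add: pos_divide_le_eq)
  then show "stabilized w g (- f) \<le> c"
    using stabilized_le[of "- f" n] by simp
  show "stabilized w g (f + h) \<le> c" if "stabilized w g h < c"
  proof -
    from stabilized_lessE[OF \<open>stabilized w g h < c\<close>] obtain m where m: "w (g ^ m * h) < c * w g ^ m" .
    define k where "k = max m n"
    have "w (g ^ k * (f + h)) \<le> max (w (g ^ k * f)) (w (g ^ k * h))"
      by (simp add: distrib_left wD(5))
    also have "\<dots> \<le> c * w g ^ k"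
      using stabilized_less_mono[OF n, of k] stabilized_less_mono[OF m, of k] by (simp add: k_def)
    finally have "w (g ^ k * (f + h)) / w g ^ k \<le> c"
      using g by (simp add: pos_divide_le_eq)
    then show ?thesis using stabilized_le[of "f + h" k] by simp
  qed
next
  note wD = um_seminormD[OF w]
  fix f h b c assume f: "stabilized w g f < b" and h: "stabilized w g h < c"
  obtain n where n: "w (g ^ n * f) < b * w g ^ n" using stabilized_lessE[OF f] .
  obtain m where m: "w (g ^ m * h) < c * w g ^ m" using stabilized_lessE[OF h] .
  \<comment> \<open>The exponents add: \<open>g ^ n\<close> is spent on \<open>f\<close> and
    \<open>g ^ m\<close> on \<open>h\<close>.\<close>
  have "w (g ^ (n + m) * (f * h)) \<le> w (g ^ n * f) * w (g ^ m * h)"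
    using wD(6)[of "g ^ n * f" "g ^ m * h"] by (simp add: power_add mult_ac)
  also have "\<dots> \<le> (b * w g ^ n) * (c * w g ^ m)"
    using n m wD(1)[of "g ^ n * f"] wD(1)[of "g ^ m * h"] by (intro mult_mono) auto
  finally have "w (g ^ (n + m) * (f * h)) / w g ^ (n + m) \<le> b * c"
    using g by (simp add: field_simps power_add)
  then show "stabilized w g (f * h) \<le> b * c"
    using stabilized_le[of "f * h" "n + m"] by simp
qed

end

section \<open>Minimal seminorms dominating an element\<close>

text \<open>These axioms are common to the Banach rings of (a) and the trivially normed rings of
  (b). The ring may be noncommutative.\<close>

locale um_normed_ring = ring R for R (structure) +
  fixes nr :: "'a \<Rightarrow> real" and a :: 'a
  assumes a_closed [simp]: "a \<in> carrier R"
    and nr_nonneg: "x \<in> carrier R \<Longrightarrow> 0 \<le> nr x"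
    and nr_zero [simp]: "nr \<zero> = 0" and nr_one [simp]: "nr \<one> = 1"
    and nr_uminus: "x \<in> carrier R \<Longrightarrow> nr (\<ominus> x) = nr x"
    and nr_add: "x \<in> carrier R \<Longrightarrow> y \<in> carrier R \<Longrightarrow> nr (x \<oplus> y) \<le> max (nr x) (nr y)"
    and nr_mult: "x \<in> carrier R \<Longrightarrow> y \<in> carrier R \<Longrightarrow> nr (x \<otimes> y) \<le> nr x * nr y"
begin

section \<open>Evaluation of integer polynomials at \<open>a\<close>, and the balls built from
  it\<close>

definition ev :: "int poly \<Rightarrow> 'a" where
  "ev f = fold_coeffs (\<lambda>c r. [c] \<cdot> \<one> \<oplus> a \<otimes> r) f \<zero>"

lemma add_pow_int_0 [simp]: "[(0 :: int)] \<cdot> x = \<zero>"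
  by (simp add: add_pow_int_ge)

lemma ev_0 [simp]: "ev 0 = \<zero>"
  by (simp add: ev_def)

lemma ev_pCons: "ev (pCons c f) = [c] \<cdot> \<one> \<oplus> a \<otimes> ev f"
proof (cases "c = 0 \<and> f = 0")
  case True
  then show ?thesis by (simp add: ev_def)
next
  case False
  then show ?thesis
    by (cases "c = 0") (simp_all add: ev_def fold_coeffs_pCons_coeff_not_0_eq fold_coeffs_pCons_not_0_0_eq)
qed

lemma ev_closed [simp]: "ev f \<in> carrier R"
  by (induction f) (simp_all add: ev_pCons)

lemma ev_1 [simp]: "ev 1 = \<one>"
  by (simp add: one_pCons ev_pCons)

lemma ev_X [simp]: "ev [:0, 1:] = a"
  by (simp add: ev_pCons)

lemma ev_add: "ev (f + g) = ev f \<oplus> ev g"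
proof (induction f g rule: poly_induct2)
  case (pCons c f d g)
  then show ?case
    by (simp add: ev_pCons add.int_pow_mult r_distr a_ac)
qed simp

lemma ev_smult: "ev (smult c f) = [c] \<cdot> ev f"
proof (induction f)
  case (pCons d f)
  have "[c] \<cdot> ([d] \<cdot> \<one> \<oplus> a \<otimes> ev f) = [c] \<cdot> ([d] \<cdot> \<one>) \<oplus> [c] \<cdot> (a \<otimes> ev f)"
    by (rule add.int_pow_distrib) simp_all
  also have "[c] \<cdot> ([d] \<cdot> \<one>) = [(c * d)] \<cdot> \<one>"
    by (simp add: add.int_pow_pow mult.commute)
  finally show ?case
    using pCons by (simp add: ev_pCons add_pow_rdistr_int)
qed simp

lemma ev_uminus: "ev (- f) = \<ominus> ev f"
proof -
  have "ev (- f) \<oplus> ev f = \<zero>" by (simp flip: ev_add)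
  then show ?thesis by (simp add: minus_equality[symmetric])
qed

lemma ev_diff: "ev (f - g) = ev f \<ominus> ev g"
  using ev_add[of f "- g"] by (simp add: ev_uminus a_minus_def)

lemma ev_mult: "ev (f * g) = ev f \<otimes> ev g"
proof (induction f)
  case (pCons c f)
  have "[c] \<cdot> \<one> \<otimes> ev g = [c] \<cdot> ev g" by (simp add: add_pow_ldistr_int)
  then show ?case
    using pCons by (simp add: ev_add ev_smult ev_pCons l_distr m_assoc)
qed simp

lemma ev_commute: "ev f \<otimes> ev g = ev g \<otimes> ev f"
  by (metis ev_mult mult.commute)

text \<open>Each application of \<open>step\<close> adds one summand to a representation, so finite
  sums are handled by rule induction. A maximum of finitely many terms is below
  \<open>\<epsilon>\<close> iff every term is, hence the strict bound on each summand.\<close>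

inductive_set ball :: "(int poly \<Rightarrow> real) \<Rightarrow> real \<Rightarrow> 'a set" for w \<epsilon> where
  zero: "\<zero> \<in> ball w \<epsilon>"
| step: "\<lbrakk>r \<in> ball w \<epsilon>; s \<in> carrier R; w f * nr s < \<epsilon>\<rbrakk> \<Longrightarrow> ev f \<otimes> s \<oplus> r \<in> ball w \<epsilon>"

lemma ball_carrier: "r \<in> ball w \<epsilon> \<Longrightarrow> r \<in> carrier R"
  by (induction rule: ball.induct) simp_all

lemma ball_ev_mult: "\<lbrakk>s \<in> carrier R; w f * nr s < \<epsilon>\<rbrakk> \<Longrightarrow> ev f \<otimes> s \<in> ball w \<epsilon>"
  using ball.step[OF ball.zero, of s w f \<epsilon>] by simp

lemma ball_ev: "w f < \<epsilon> \<Longrightarrow> ev f \<in> ball w \<epsilon>"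
  using ball_ev_mult[of \<one> w f \<epsilon>] by simp

lemma ball_add: "r \<in> ball w \<epsilon> \<Longrightarrow> s \<in> ball w \<epsilon> \<Longrightarrow> r \<oplus> s \<in> ball w \<epsilon>"
proof (induction rule: ball.induct)
  case zero
  then show ?case by (simp add: ball_carrier)
next
  case (step r t f)
  then have "ev f \<otimes> t \<oplus> (r \<oplus> s) \<in> ball w \<epsilon>" by (intro ball.step) simp_all
  then show ?case using step by (simp add: ball_carrier a_assoc)
qed

lemma ball_uminus: "r \<in> ball w \<epsilon> \<Longrightarrow> \<ominus> r \<in> ball w \<epsilon>"
proof (induction rule: ball.induct)
  case (step r s f)
  then have "ev f \<otimes> (\<ominus> s) \<oplus> (\<ominus> r) \<in> ball w \<epsilon>" by (intro ball.step) (simp_all add: nr_uminus)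
  then show ?case using step by (simp add: ball_carrier r_minus minus_add)
qed (simp add: ball.zero)

lemma ball_mono: assumes "\<epsilon> \<le> \<delta>" shows "r \<in> ball w \<epsilon> \<Longrightarrow> r \<in> ball w \<delta>"
  by (induction rule: ball.induct) (use assms in \<open>auto intro: ball.intros\<close>)

text \<open>Finitely many strict inequalities leave room for a smaller radius.\<close>

lemma ball_shrink:
  "r \<in> ball w \<epsilon> \<Longrightarrow> \<epsilon> > 0 \<Longrightarrow> \<exists>\<delta>>0. \<delta> < \<epsilon> \<and> r \<in> ball w \<delta>"
proof (induction rule: ball.induct)
  case zero
  then show ?case by (auto intro!: exI[of _ "\<epsilon> / 2"] ball.zero)
next
  case (step r s f)
  then obtain \<delta> where \<delta>: "\<delta> > 0" "\<delta> < \<epsilon>" "r \<in> ball w \<delta>" by blast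
  obtain \<gamma> where \<gamma>: "max \<delta> (w f * nr s) < \<gamma>" "\<gamma> < \<epsilon>"
    using dense[of "max \<delta> (w f * nr s)" \<epsilon>] \<delta> step by auto
  then have "ev f \<otimes> s \<oplus> r \<in> ball w \<gamma>"
    using step \<delta> by (intro ball.step ball_mono[of \<delta> \<gamma>]) auto
  then show ?case using \<gamma> \<delta> by (intro exI[of _ \<gamma>]) auto
qed

text \<open>A summand \<open>ev g \<otimes> t\<close> of \<open>r\<close> turns into
  \<open>ev (f * g) \<otimes> (t \<otimes> s)\<close>: the polynomial factors are collected on the
  left without moving any ring element past another, and the bounds multiply.\<close>

lemma ball_sandwich:
  assumes w: "um_seminorm w" and s: "s \<in> carrier R" and c: "w f * nr s \<le> c" "c > 0"
  shows "r \<in> ball w \<epsilon> \<Longrightarrow> ev f \<otimes> (r \<otimes> s) \<in> ball w (\<epsilon> * c)"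
proof (induction rule: ball.induct)
  case zero
  then show ?case using s by (simp add: ball.zero)
next
  case (step r t g)
  have "w (f * g) * nr (t \<otimes> s) \<le> (w f * w g) * (nr t * nr s)"
    using um_seminormD[OF w] nr_mult[of t s] nr_nonneg[of "t \<otimes> s"] step s by (intro mult_mono) auto
  also have "\<dots> = (w g * nr t) * (w f * nr s)" by simp
  also have "\<dots> \<le> (w g * nr t) * c"
    using c um_seminormD(1)[OF w] nr_nonneg step by (intro mult_left_mono) simp_all
  also have "\<dots> < \<epsilon> * c" using step c by simp
  finally have "ev (f * g) \<otimes> (t \<otimes> s) \<oplus> ev f \<otimes> (r \<otimes> s) \<in> ball w (\<epsilon> * c)"
    using step s by (intro ball.step) simp_all
  then show ?case
    using step s by (simp add: ball_carrier ev_mult l_distr r_distr m_assoc)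
qed

text \<open>Submultiplicativity of the balls when the left factor is a value of \<open>ev\<close>.
  Such a factor commutes past the polynomial part of each summand of \<open>r\<close>, after which
  \<open>ball_sandwich\<close> applies.\<close>

lemma ball_ev_mult_ball:
  assumes w: "um_seminorm w" and h: "ev h \<in> ball w \<eta>" and "\<eta> > 0" "\<epsilon> > 0"
  shows "r \<in> ball w \<epsilon> \<Longrightarrow> ev h \<otimes> r \<in> ball w (\<eta> * \<epsilon>)"
proof (induction rule: ball.induct)
  case zero
  then show ?case by (simp add: ball.zero)
next
  case (step r s f)
  have "ev f \<otimes> (ev h \<otimes> s) \<in> ball w (\<eta> * \<epsilon>)"
    using step assms by (intro ball_sandwich) auto
  moreover have "ev f \<otimes> (ev h \<otimes> s) = ev h \<otimes> (ev f \<otimes> s)"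
    using step by (simp add: m_assoc[symmetric] ev_commute)
  ultimately show ?case
    using step by (simp add: r_distr ball_carrier ball_add)
qed

text \<open>A representation involves only finitely many strict inequalities, so a single member of
  the chain already satisfies them all. This makes admissibility pass to infima of chains.\<close>

lemma ball_chain:
  assumes "C \<noteq> {}" and chain: "\<And>w w'. w \<in> C \<Longrightarrow> w' \<in> C \<Longrightarrow> w \<le> w' \<or> w' \<le> w"
    and bdd: "\<And>w f. w \<in> C \<Longrightarrow> 0 \<le> w f"
  shows "r \<in> ball (\<lambda>f. INF w\<in>C. w f) \<epsilon> \<Longrightarrow> \<exists>w\<in>C. r \<in> ball w \<epsilon>"
proof (induction rule: ball.induct)
  case zero
  then show ?case using assms(1) ball.zero by blast
next
  case (step r s f)
  then obtain w where w: "w \<in> C" "r \<in> ball w \<epsilon>" by blast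
  obtain w' where w': "w' \<in> C" "w' f * nr s < \<epsilon>"
  proof (cases "nr s = 0")
    case True
    then show ?thesis using that[OF w(1)] step by simp
  next
    case False
    then have pos: "nr s > 0" using nr_nonneg[of s] step by simp
    then have "(INF w\<in>C. w f) < \<epsilon> / nr s" using step by (simp add: field_simps)
    from cInf_lessD[OF _ this] obtain w' where "w' \<in> C" "w' f < \<epsilon> / nr s" using assms(1) by auto
    then show ?thesis using that[of w'] pos by (simp add: field_simps)
  qed
  \<comment> \<open>Balls grow when the seminorm shrinks, so the smaller of \<open>w\<close> and
    \<open>w'\<close> serves both for \<open>r\<close> and for the new summand.\<close>
  have anti: "x \<in> ball u' \<epsilon>" if "u' \<le> u" "x \<in> ball u \<epsilon>" for x u u'
    using that(2)
  proof (induction rule: ball.induct)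
    case (step r s f)
    have "u' f * nr s \<le> u f * nr s"
      using that(1) nr_nonneg step by (intro mult_right_mono) (auto simp: le_fun_def)
    then show ?case using step by (intro ball.step) auto
  qed (rule ball.zero)
  show ?case
  proof (cases "w' \<le> w")
    case True
    then show ?thesis using w w' step anti[OF True w(2)] by (intro bexI[of _ w'] ball.step) auto
  next
    case False
    then have "w \<le> w'" using chain[OF w(1) w'(1)] by blast
    then have "w f * nr s \<le> w' f * nr s"
      using nr_nonneg step by (intro mult_right_mono) (auto simp: le_fun_def)
    then show ?thesis using w w' step by (intro bexI[of _ w] ball.step) auto
  qed
qed

section \<open>Existence of a minimal admissible seminorm\<close>

definition admissible :: "(int poly \<Rightarrow> real) \<Rightarrow> bool" where
  "admissible w \<longleftrightarrow> um_seminorm w \<and> \<one> \<notin> ball w 1"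

text \<open>For this seminorm the ultrametric inequality bounds the norm of every element of a ball
  by its radius, and \<open>\<one>\<close> has norm 1. It serves as the bound of the empty chain in
  Zorn's lemma.\<close>

lemma admissible_nr_ev: "admissible (\<lambda>f. nr (ev f))"
proof -
  have "um_seminorm (\<lambda>f. nr (ev f))"
    unfolding um_seminorm_def
    by (simp add: nr_nonneg ev_uminus nr_uminus ev_add nr_add ev_mult nr_mult)
  moreover have "nr r < \<epsilon>" if "r \<in> ball (\<lambda>f. nr (ev f)) \<epsilon>" "\<epsilon> > 0" for r \<epsilon>
    using that
  proof (induction rule: ball.induct)
    case (step r s f)
    then show ?case
      using nr_add[of "ev f \<otimes> s" r] nr_mult[of "ev f" s] by (auto simp: ball_carrier)
  qed simp
  from this[of \<one> 1] have "\<one> \<notin> ball (\<lambda>f. nr (ev f)) 1" by auto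
  ultimately show ?thesis by (simp add: admissible_def)
qed

lemma ex_minimal_admissible:
  "\<exists>w. admissible w \<and> (\<forall>w'. admissible w' \<longrightarrow> w' \<le> w \<longrightarrow> w' = w)"
proof -
  \<comment> \<open>The order is reversed, so that Zorn's lemma yields a minimal element.\<close>
  let ?P = "\<lambda>w w' :: int poly \<Rightarrow> real. w' \<le> w"
  have "\<exists>m\<in>Collect admissible. \<forall>w\<in>Collect admissible. ?P m w \<longrightarrow> w = m"
  proof (rule predicate_Zorn)
    show "partial_order_on (Collect admissible) (relation_of ?P (Collect admissible))"
      by (rule partial_order_on_relation_ofI) auto
  next
    fix C assume C: "C \<in> Chains (relation_of ?P (Collect admissible))"
    then have adm: "admissible w" if "w \<in> C" for w
      using that by (auto simp: Chains_def relation_of_def)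
    have chain: "w \<le> w' \<or> w' \<le> w" if "w \<in> C" "w' \<in> C" for w w'
      using C that by (auto simp: Chains_def relation_of_def)
    have sn: "um_seminorm w" if "w \<in> C" for w
      using adm[OF that] by (simp add: admissible_def)
    show "\<exists>u\<in>Collect admissible. \<forall>w\<in>C. u \<le> w"
    proof (cases "C = {}")
      case True
      then show ?thesis using admissible_nr_ev by auto
    next
      case False
      define u where "u f = (INF w\<in>C. w f)" for f
      have bdd: "bdd_below ((\<lambda>w. w f) ` C)" for f
        using um_seminormD(1)[OF sn] by (auto intro!: bdd_belowI[of _ 0])
      have u_le: "u f \<le> w f" if "w \<in> C" for w f
        unfolding u_def by (rule cINF_lower[OF bdd that])
      have u_less: "\<exists>w\<in>C. w f < c" if "u f < c" for f c
        using cInf_lessD[OF _ that[unfolded u_def]] False by auto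
      \<comment> \<open>Of the two witnesses, the smaller member of the chain meets both
        bounds.\<close>
      have u_less2: "\<exists>w\<in>C. w f < b \<and> w g < c" if fg: "u f < b" "u g < c" for f g b c
      proof -
        obtain w w' where w: "w \<in> C" "w f < b" and w': "w' \<in> C" "w' g < c"
          using u_less[OF fg(1)] u_less[OF fg(2)] by blast
        then have "w' f < b \<or> w g < c"
          using chain[OF w(1) w'(1)] by (metis le_fun_def le_less_trans)
        then show ?thesis using w w' by blast
      qed
      obtain w0 where w0: "w0 \<in> C" using False by blast
      have "um_seminorm u"
      proof (rule um_seminormI)
        show nonneg: "0 \<le> u f" for f
          unfolding u_def by (rule cINF_greatest[OF False]) (rule um_seminormD(1)[OF sn])
        show "u 0 = 0" "u 1 \<le> 1"
          using u_le[OF w0] um_seminormD(2,3)[OF sn[OF w0]] nonneg[of 0] by (metis order_antisym, metis order_trans)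
      next
        fix f c assume "u f < c"
        then obtain w where "w \<in> C" "w f < c" using u_less by blast
        then show "u (- f) \<le> c" using u_le[of w "- f"] um_seminormD(4)[OF sn, of w f] by simp
      next
        fix f g c assume "u f < c" "u g < c"
        then obtain w where "w \<in> C" "w f < c" "w g < c" using u_less2 by blast
        then show "u (f + g) \<le> c"
          using u_le[of w "f + g"] um_seminormD(5)[OF sn, of w f g] by simp
      next
        fix f g b c assume "u f < b" "u g < c"
        then obtain w where w: "w \<in> C" "w f < b" "w g < c" using u_less2 by blast
        have "w f * w g \<le> b * c"
          using w um_seminormD(1)[OF sn[OF w(1)], of f] um_seminormD(1)[OF sn[OF w(1)], of g]
          by (intro mult_mono) simp_all
        then show "u (f * g) \<le> b * c"
          using w u_le[of w "f * g"] um_seminormD(6)[OF sn, of w f g] by simp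
      qed
      moreover have "\<one> \<notin> ball u 1"
        using ball_chain[OF False chain, of \<one> 1] um_seminormD(1)[OF sn] adm
        by (auto simp: u_def[abs_def] admissible_def)
      ultimately show ?thesis
        using u_le by (intro bexI[of _ u]) (auto simp: admissible_def le_fun_def)
    qed
  qed
  then show ?thesis by blast
qed

text \<open>If the powers of \<open>ev g\<close> grow at most like \<open>B * d ^ i\<close>,
  replacing \<open>w\<close> by \<open>lowered w g d\<close> costs only the factor \<open>B\<close>:
  a coefficient \<open>f\<close> is expanded in powers of \<open>g\<close>, and each
  \<open>ev (coeff P i) \<otimes> (ev (g ^ i) \<otimes> s)\<close> is estimated by
  \<open>ball_sandwich\<close>.\<close>

lemma ball_lowered:
  assumes w: "um_seminorm w" and d: "d > 0" and B: "B > 0" and g: "\<And>i. ev (g ^ i) \<in> ball w (B * d ^ i)"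
    and \<epsilon>: "\<epsilon> > 0"
  shows "r \<in> ball (lowered w g d) \<epsilon> \<Longrightarrow> r \<in> ball w (B * \<epsilon>)"
proof (induction rule: ball.induct)
  case (step r s f)
  \<comment> \<open>A non-strict bound suffices here, since the balls containing the powers of
    \<open>ev g\<close> are strict.\<close>
  obtain P where P: "poly P g = f" "\<And>i. w (coeff P i) * d ^ i * nr s \<le> \<epsilon>"
  proof (cases "nr s = 0")
    case True
    then show ?thesis using that[of "[:f:]"] \<epsilon> by simp
  next
    case False
    then have pos: "nr s > 0" using nr_nonneg[of s] step by simp
    then have "lowered w g d f < \<epsilon> / nr s" using step by (simp add: field_simps)
    from lowered_lessE[OF w d this] obtain P
      where P: "poly P g = f" "\<And>i. w (coeff P i) * d ^ i < \<epsilon> / nr s" by blast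
    have "w (coeff P i) * d ^ i * nr s \<le> \<epsilon>" for i
      using P(2)[of i] pos by (simp add: pos_less_divide_eq)
    then show ?thesis using that P by blast
  qed
  have summand: "ev (coeff P i * g ^ i) \<otimes> s \<in> ball w (B * \<epsilon>)" for i
  proof -
    have "ev (coeff P i) \<otimes> (ev (g ^ i) \<otimes> s) \<in> ball w ((B * d ^ i) * (\<epsilon> / d ^ i))"
      by (rule ball_sandwich[OF w _ _ _ g]) (use step P(2)[of i] d \<epsilon> in \<open>simp_all add: field_simps\<close>)
    then show ?thesis using d step by (simp add: ev_mult m_assoc)
  qed
  have "ev (\<Sum>i\<in>A. coeff P i * g ^ i) \<otimes> s \<in> ball w (B * \<epsilon>)" if "finite A" for A
    using that
  proof (induction A rule: finite_induct)
    case (insert i A)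
    then show ?case using step summand by (simp add: ev_add l_distr ball_add)
  qed (use step in \<open>simp add: ball.zero\<close>)
  from this[of "{..degree P}"] have "ev f \<otimes> s \<in> ball w (B * \<epsilon>)"
    using P(1) by (simp add: poly_altdef)
  then show ?case using step by (simp add: ball_add)
qed (rule ball.zero)

section \<open>Multiplicativity of a minimal admissible seminorm\<close>

context
  fixes w assumes adm: "admissible w" and minimal: "\<And>w'. admissible w' \<Longrightarrow> w' \<le> w \<Longrightarrow> w' = w"
begin

lemma minimal_um_seminorm: "um_seminorm w" and one_notin: "\<one> \<notin> ball w 1"
  using adm by (auto simp: admissible_def)

text \<open>Under this growth condition \<open>lowered w g d\<close> is still admissible. By
  minimality it equals \<open>w\<close>, whose value at \<open>g\<close> is therefore at most
  \<open>d\<close>.\<close>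

lemma minimal_le:
  assumes d: "d > 0" and B: "B > 0" and g: "\<And>i. ev (g ^ i) \<in> ball w (B * d ^ i)"
  shows "w g \<le> d"
proof -
  let ?u = "lowered w g d"
  note u = um_seminorm_lowered[OF minimal_um_seminorm d, of g]
  have "\<one> \<notin> ball ?u 1"
  proof
    assume "\<one> \<in> ball ?u 1"
    then obtain \<theta> where \<theta>: "0 < \<theta>" "\<theta> < 1" "\<one> \<in> ball ?u \<theta>" using ball_shrink by force
    \<comment> \<open>Submultiplicativity turns the gap below 1 into geometric decay, which absorbs
      the constant \<open>B\<close> lost on the way back from \<open>lowered w g d\<close> to
      \<open>w\<close>.\<close>
    have pow: "\<one> \<in> ball ?u (\<theta> ^ Suc n)" for n
    proof (induction n)
      case (Suc n)
      then show ?case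
        using ball_ev_mult_ball[OF u, of 1 \<theta> "\<theta> ^ Suc n" \<one>] \<theta> by simp
    qed (use \<theta> in simp)
    obtain n where n: "\<theta> ^ n < 1 / B"
      using real_arch_pow_inv[of "1 / B" \<theta>] \<theta> B by auto
    have "B * \<theta> ^ Suc n \<le> B * \<theta> ^ n" using \<theta> B by (simp add: mult_le_cancel_right1)
    also have "\<dots> \<le> 1" using n B by (simp add: field_simps)
    finally have "\<one> \<in> ball w 1"
      using ball_mono ball_lowered[OF minimal_um_seminorm d B g _ pow[of n]] \<theta> by (metis zero_less_power)
    then show False using one_notin by simp
  qed
  then have "?u = w"
    using u lowered_le_self[OF minimal_um_seminorm d, of g] by (intro minimal) (auto simp: admissible_def le_fun_def)
  then show ?thesis using lowered_le_bound[OF minimal_um_seminorm d, of g] by simp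
qed

text \<open>If \<open>w (g ^ n)\<close> fell short of \<open>w g ^ n\<close>, its
  \<open>n\<close>-th root would leave room for some \<open>d < w g\<close>. Division of
  \<open>i\<close> by \<open>n\<close> with remainder bounds \<open>w (g ^ i)\<close> by a constant
  times \<open>d ^ i\<close>, contradicting \<open>minimal_le\<close>.\<close>

lemma minimal_power: "w (g ^ n) = w g ^ n"
proof (rule ccontr)
  assume "w (g ^ n) \<noteq> w g ^ n"
  then have less: "w (g ^ n) < w g ^ n" using um_seminorm_power[OF minimal_um_seminorm, of g n] by simp
  have n: "n > 0"
  proof (rule ccontr)
    assume "\<not> 0 < n"
    then show False using less one_notin ball_ev[of w 1 1] by simp
  qed
  have wn: "0 \<le> w (g ^ n)" using um_seminormD(1)[OF minimal_um_seminorm] .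
  have wg: "w g > 0" using um_seminormD(1)[OF minimal_um_seminorm, of g] less wn zero_power[OF n, where ?'a = real]
    by (cases "w g = 0") auto
  have "root n (w (g ^ n)) < w g"
    using less n wg real_root_less_mono[OF n less] by (simp add: real_root_power_cancel)
  then obtain d where d: "root n (w (g ^ n)) < d" "d < w g" using dense by blast
  have d0: "d > 0" using d(1) n wn real_root_ge_zero[OF wn, of n] by linarith
  have dn: "w (g ^ n) \<le> d ^ n"
    using d(1) n wn d0 power_mono[of "root n (w (g ^ n))" d n] by simp
  \<comment> \<open>This dominates \<open>(w g / d) ^ (i mod n)\<close>, the cost of the remainder,
    because \<open>w g / d > 1\<close>.\<close>
  let ?B = "(w g / d) ^ n"
  have bound: "w (g ^ i) \<le> ?B * d ^ i" for i
  proof -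
    have i: "g ^ i = (g ^ n) ^ (i div n) * g ^ (i mod n)"
      by (simp flip: power_mult power_add)
    have "w (g ^ i) \<le> w ((g ^ n) ^ (i div n)) * w (g ^ (i mod n))"
      unfolding i by (rule um_seminormD(6)[OF minimal_um_seminorm])
    also have "\<dots> \<le> (d ^ n) ^ (i div n) * w g ^ (i mod n)"
      using order_trans[OF um_seminorm_power[OF minimal_um_seminorm] power_mono[OF dn wn]] d0 um_seminormD(1)[OF minimal_um_seminorm]
      by (intro mult_mono um_seminorm_power[OF minimal_um_seminorm]) auto
    also have "\<dots> = d ^ i * (w g / d) ^ (i mod n)"
    proof -
      have "d ^ i = (d ^ n) ^ (i div n) * d ^ (i mod n)" by (simp flip: power_mult power_add)
      then show ?thesis using d0 by (simp add: power_divide)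
    qed
    also have "\<dots> \<le> d ^ i * ?B"
      using d d0 n by (intro mult_left_mono power_increasing) (auto simp: less_imp_le)
    finally show ?thesis by (simp add: mult.commute)
  qed
  have B: "?B > 0" using wg d0 by simp
  \<comment> \<open>Doubling the constant makes the inequality strict.\<close>
  have "ev (g ^ i) \<in> ball w ((2 * ?B) * d ^ i)" for i
  proof (rule ball_ev)
    have "0 < ?B * d ^ i" using B d0 by simp
    then show "w (g ^ i) < (2 * ?B) * d ^ i"
      unfolding mult.assoc using bound[of i] by linarith
  qed
  then have "w g \<le> d"
    using d0 B by (intro minimal_le[of d "2 * ?B"]) auto
  then show False using d by simp
qed

text \<open>Otherwise \<open>ev g\<close> lies in a ball of some radius \<open>d < w g\<close>;
  submultiplicativity carries this over to all powers, and \<open>minimal_le\<close> gives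
  \<open>w g \<le> d\<close>.\<close>

lemma minimal_ev_notin_ball: assumes g: "w g \<noteq> 0" shows "ev g \<notin> ball w (w g)"
proof
  assume "ev g \<in> ball w (w g)"
  moreover have "w g > 0" using g um_seminormD(1)[OF minimal_um_seminorm, of g] by simp
  ultimately obtain d where d: "d > 0" "d < w g" "ev g \<in> ball w d" using ball_shrink by blast
  \<comment> \<open>The factor 2 takes care of \<open>i = 0\<close>, where
    \<open>w 1 \<le> 1\<close> is not strict.\<close>
  have "ev (g ^ i) \<in> ball w (2 * d ^ i)" for i
  proof (induction i)
    case 0
    show ?case using ball_ev[of w 1 2] um_seminormD(3)[OF minimal_um_seminorm] by simp
  next
    case (Suc i)
    then have "ev (g ^ i) \<otimes> ev g \<in> ball w ((2 * d ^ i) * d)"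
      using d by (intro ball_ev_mult_ball[OF minimal_um_seminorm]) auto
    then show ?case by (simp add: ev_mult ev_commute mult_ac)
  qed
  then have "w g \<le> d" using d by (intro minimal_le[of d 2]) auto
  then show False using d by simp
qed

lemma minimal_one: "w 1 = 1"
  using one_notin ball_ev[of w 1 1] um_seminormD(3)[OF minimal_um_seminorm] by fastforce

text \<open>For \<open>w g \<noteq> 0\<close> the seminorm \<open>stabilized w g\<close> is
  admissible, since \<open>\<one>\<close> in its unit ball would put some \<open>ev (g ^ n)\<close>
  into the ball of radius \<open>w (g ^ n)\<close>. By minimality it equals \<open>w\<close>, and
  the exponent 1 in the infimum gives the missing inequality.\<close>

lemma minimal_mult: "w (g * f) = w g * w f"
proof (cases "w g = 0")
  case True
  then show ?thesis
    using um_seminormD(6)[OF minimal_um_seminorm, of g f] um_seminormD(1)[OF minimal_um_seminorm, of "g * f"] by simp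
next
  case False
  then have g: "w g > 0" using um_seminormD(1)[OF minimal_um_seminorm, of g] by simp
  let ?u = "stabilized w g"
  note le = stabilized_le[OF minimal_um_seminorm g minimal_power]
  \<comment> \<open>Once an exponent is good for a summand, all larger ones are, so a common
    exponent exists for the whole sum.\<close>
  have less: "r \<in> ball ?u 1 \<Longrightarrow> \<exists>n. \<forall>m\<ge>n. ev (g ^ m) \<otimes> r \<in> ball w (w g ^ m)" for r
  proof (induction rule: ball.induct)
    case zero
    then show ?case by (simp add: ball.zero)
  next
    case (step r s f)
    then obtain n where n: "\<And>m. m \<ge> n \<Longrightarrow> ev (g ^ m) \<otimes> r \<in> ball w (w g ^ m)" by blast
    obtain k where k: "\<And>m. m \<ge> k \<Longrightarrow> w (g ^ m * f) * nr s < w g ^ m"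
    proof (cases "nr s = 0")
      case True
      then show ?thesis using that[of 0] g by simp
    next
      case False
      then have pos: "nr s > 0" using nr_nonneg[of s] step by simp
      then have "?u f < 1 / nr s" using step by (simp add: field_simps)
      from stabilized_lessE[OF minimal_um_seminorm g minimal_power this]
      obtain k where k: "w (g ^ k * f) < 1 / nr s * w g ^ k" .
      have "w (g ^ m * f) * nr s < w g ^ m" if "m \<ge> k" for m
        using stabilized_less_mono[OF minimal_um_seminorm g minimal_power k that] pos by (simp add: field_simps)
      then show ?thesis using that by blast
    qed
    have "ev (g ^ m) \<otimes> (ev f \<otimes> s \<oplus> r) \<in> ball w (w g ^ m)" if "m \<ge> max n k" for m
    proof -
      have "ev (g ^ m * f) \<otimes> s \<oplus> ev (g ^ m) \<otimes> r \<in> ball w (w g ^ m)"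
        using n[of m] k[of m] step that by (intro ball.step) auto
      then show ?thesis using step by (simp add: ev_mult r_distr m_assoc ball_carrier)
    qed
    then show ?case by blast
  qed
  have "\<one> \<notin> ball ?u 1"
  proof
    assume "\<one> \<in> ball ?u 1"
    from less[OF this] obtain n where "ev (g ^ n) \<in> ball w (w g ^ n)" by auto
    then show False
      using minimal_ev_notin_ball[of "g ^ n"] g minimal_power[of g n] by simp
  qed
  then have "?u = w"
    using um_seminorm_stabilized[OF minimal_um_seminorm g minimal_power] le[of _ 0]
    by (intro minimal) (auto simp: admissible_def le_fun_def)
  then have "w f \<le> w (g * f) / w g" using le[of f 1] by simp
  then have "w g * w f \<le> w (g * f)" using g by (simp add: field_simps)
  then show ?thesis using um_seminormD(6)[OF minimal_um_seminorm, of g f] by simp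
qed

end

end

section \<open>The tensor product\<close>

text \<open>This and the next two identities express numerators of approximating fractions through
  their errors; the terms containing the denominator cancel.\<close>

lemma (in cring) minus_minus_cancel:
  "\<lbrakk>x \<in> carrier R; p \<in> carrier R\<rbrakk> \<Longrightarrow> x \<ominus> (x \<ominus> p) = p"
  by algebra

lemma (in cring) add_minus_cancel:
  "\<lbrakk>x \<in> carrier R; y \<in> carrier R; p \<in> carrier R; q \<in> carrier R; r \<in> carrier R\<rbrakk> \<Longrightarrow>
   (x \<ominus> p) \<oplus> (y \<ominus> q) \<ominus> ((x \<oplus> y) \<ominus> r) = r \<ominus> p \<ominus> q"
  by algebra

lemma (in cring) mult_minus_cancel:
  "\<lbrakk>s \<in> carrier R; g \<in> carrier R; x \<in> carrier R; p \<in> carrier R; r \<in> carrier R\<rbrakk> \<Longrightarrow>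
   s \<otimes> (g \<otimes> x \<ominus> p) \<ominus> (g \<otimes> (s \<otimes> x) \<ominus> r) = r \<ominus> s \<otimes> p"
  by algebra

lemma tfs_Nil: "tfs [] = (\<lambda>_. 0)"
  and tfs_Cons: "tfs (p # L) = (\<lambda>q. tfs [p] q + tfs L q)"
  and tfs_append: "tfs (L @ M) = (\<lambda>q. tfs L q + tfs M q)"
  and tfs_single: "tfs [p] q = (if q = p then 1 else 0)"
  by (auto simp: tfs_def fun_eq_iff)

text \<open>\<open>Q\<close> stands for a subgroup, later both \<open>small\<close> and
  \<open>representable\<close>; the combination is the one produced by
  \<open>tmult_telem\<close>.\<close>

lemma closed_under_int_combination:
  fixes h :: "'i \<Rightarrow> 'p \<Rightarrow> int"
  assumes zero: "Q (\<lambda>_. 0)" and add: "\<And>f g. Q f \<Longrightarrow> Q g \<Longrightarrow> Q (\<lambda>p. f p + g p)"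
    and neg: "\<And>f. Q f \<Longrightarrow> Q (\<lambda>p. - f p)"
    and "finite A" "\<And>x. x \<in> A \<Longrightarrow> Q (h x)"
  shows "Q (\<lambda>p. \<Sum>x\<in>A. c x * h x p)"
  using assms(4,5)
proof (induction A rule: finite_induct)
  case (insert x A)
  have "Q (\<lambda>p. k * h x p)" for k
  proof (induction k rule: int_induct[where k = 0])
    case (step1 i)
    then show ?case using add[OF step1(2) insert.prems[of x]] by (simp add: algebra_simps)
  next
    case (step2 i)
    then show ?case using add[OF step2(2) neg[OF insert.prems[of x]]] by (simp add: algebra_simps)
  qed (simp add: zero)
  then show ?case using add[of "\<lambda>p. c x * h x p" "\<lambda>p. \<Sum>x\<in>A. c x * h x p"] insert by simp
qed (simp add: zero)

lemma fsums_zero: "(\<lambda>_. 0) \<in> fsums R K"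
  by (simp add: fsums_def)

lemma fsums_add: assumes "f \<in> fsums R K" "g \<in> fsums R K" shows "(\<lambda>p. f p + g p) \<in> fsums R K"
proof -
  have "{p. f p + g p \<noteq> 0} \<subseteq> {p. f p \<noteq> 0} \<union> {p. g p \<noteq> 0}" by auto
  then show ?thesis
    using assms finite_subset unfolding fsums_def by blast
qed

lemma fsums_uminus: "f \<in> fsums R K \<Longrightarrow> (\<lambda>p. - f p) \<in> fsums R K"
  by (simp add: fsums_def)

lemma fsums_single: "p \<in> carrier R \<times> carrier K \<Longrightarrow> tfs [p] \<in> fsums R K"
  by (simp add: fsums_def tfs_single)

text \<open>The support of \<open>telem\<close> lies in two points, which reduces the double sum to
  two single ones.\<close>

lemma tmult_telem:
  assumes "y \<in> fsums R K"
  shows "tmult R K (telem R K a s) y = (\<lambda>q. \<Sum>p\<in>{p. y p \<noteq> 0}. y p *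
    (tfs [(\<one>\<^bsub>R\<^esub> \<otimes>\<^bsub>R\<^esub> fst p, s \<otimes>\<^bsub>K\<^esub> snd p)] q - tfs [(a \<otimes>\<^bsub>R\<^esub> fst p, \<one>\<^bsub>K\<^esub> \<otimes>\<^bsub>K\<^esub> snd p)] q))"
proof
  fix q
  let ?x = "telem R K a s" and ?Y = "{p. y p \<noteq> 0}"
  let ?e = "(\<one>\<^bsub>R\<^esub>, s)" and ?e' = "(a, \<one>\<^bsub>K\<^esub>)"
  define G where "G p1 = (\<Sum>p\<in>?Y. y p * tfs [(fst p1 \<otimes>\<^bsub>R\<^esub> fst p, snd p1 \<otimes>\<^bsub>K\<^esub> snd p)] q)" for p1
  have x: "?x p = tfs [?e] p - tfs [?e'] p" for p
    by (simp add: telem_def tdiff_def)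
  have "tmult R K ?x y q = (\<Sum>p1\<in>{p. ?x p \<noteq> 0}. \<Sum>p2\<in>?Y.
      if (fst p1 \<otimes>\<^bsub>R\<^esub> fst p2, snd p1 \<otimes>\<^bsub>K\<^esub> snd p2) = q then ?x p1 * y p2 else 0)"
    by (simp add: tmult_def sum.cartesian_product)
  also have "\<dots> = (\<Sum>p1\<in>{p. ?x p \<noteq> 0}. ?x p1 * G p1)"
    unfolding G_def sum_distrib_left by (intro sum.cong refl) (auto simp: tfs_single)
  also have "\<dots> = (\<Sum>p1\<in>{?e, ?e'}. ?x p1 * G p1)"
    by (rule sum.mono_neutral_left) (auto simp: x tfs_single split: if_splits)
  also have "\<dots> = G ?e - G ?e'"
  \<comment> \<open>If the two points coincide, \<open>telem\<close> vanishes and both sides are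
    0.\<close>
  proof (cases "?e = ?e'")
    case True
    then have "?x ?e = 0" unfolding x by simp
    then show ?thesis using True by simp
  qed (simp add: x tfs_single)
  finally show "tmult R K ?x y q = (\<Sum>p\<in>?Y. y p *
    (tfs [(\<one>\<^bsub>R\<^esub> \<otimes>\<^bsub>R\<^esub> fst p, s \<otimes>\<^bsub>K\<^esub> snd p)] q - tfs [(a \<otimes>\<^bsub>R\<^esub> fst p, \<one>\<^bsub>K\<^esub> \<otimes>\<^bsub>K\<^esub> snd p)] q))"
    by (simp add: G_def sum_subtractf right_diff_distrib)
qed

text \<open>This says that the infimum defining \<open>tnorm\<close> is over a non-empty set;
  otherwise its value would carry no information.\<close>

definition representable :: "('r,'a) ring_scheme \<Rightarrow> ('k,'b) ring_scheme \<Rightarrow> ('r \<times> 'k \<Rightarrow> int) \<Rightarrow> bool" where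
  "representable R K f \<longleftrightarrow> (\<exists>L. set L \<subseteq> carrier R \<times> carrier K \<and> teq R K (tfs L) f)"

lemma representable_zero: "representable R K (\<lambda>_. 0)"
  unfolding representable_def teq_def
  by (rule exI[of _ "[]"]) (simp add: tfs_Nil tensor_rel.zero)

lemma representable_single: "p \<in> carrier R \<times> carrier K \<Longrightarrow> representable R K (tfs [p])"
  unfolding representable_def teq_def
  by (rule exI[of _ "[p]"]) (simp add: tensor_rel.zero)

lemma representable_add:
  assumes "representable R K f" "representable R K g" shows "representable R K (\<lambda>p. f p + g p)"
proof -
  obtain L M where "set L \<subseteq> carrier R \<times> carrier K" "set M \<subseteq> carrier R \<times> carrier K"
    and rel: "(\<lambda>p. tfs L p - f p) \<in> tensor_rel R K" "(\<lambda>p. tfs M p - g p) \<in> tensor_rel R K"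
    using assms unfolding representable_def teq_def by blast
  moreover have "(\<lambda>p. tfs (L @ M) p - (f p + g p)) = (\<lambda>p. (tfs L p - f p) + (tfs M p - g p))"
    by (simp add: tfs_append fun_eq_iff)
  ultimately show ?thesis
    using tensor_rel.add[OF rel] unfolding representable_def teq_def by (intro exI[of _ "L @ M"]) auto
qed

lemma tensor_rel_single_uminus:
  assumes "ring R" "x \<in> carrier R" "b \<in> carrier K"
  shows "(\<lambda>p. tfs [(\<ominus>\<^bsub>R\<^esub> x, b)] p + tfs [(x, b)] p) \<in> tensor_rel R K"
proof -
  interpret ring R by fact
  have 1: "(\<lambda>p. tfs [(\<ominus>\<^bsub>R\<^esub> x \<oplus>\<^bsub>R\<^esub> x, b)] p - tfs [(\<ominus>\<^bsub>R\<^esub> x, b)] p - tfs [(x, b)] p) \<in> tensor_rel R K"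
    using assms by (intro tensor_rel.left) auto
  \<comment> \<open>As \<open>\<zero> \<oplus> \<zero> = \<zero>\<close>, this relation says that
    \<open>\<zero> \<otimes> b\<close> vanishes in the tensor product.\<close>
  have 2: "(\<lambda>p. tfs [(\<zero>\<^bsub>R\<^esub> \<oplus>\<^bsub>R\<^esub> \<zero>\<^bsub>R\<^esub>, b)] p - tfs [(\<zero>\<^bsub>R\<^esub>, b)] p - tfs [(\<zero>\<^bsub>R\<^esub>, b)] p) \<in> tensor_rel R K"
    using assms by (intro tensor_rel.left) auto
  show ?thesis
    using tensor_rel.neg[OF tensor_rel.add[OF 1 2]] assms by (simp add: l_neg add.commute)
qed

lemma tensor_rel_list_uminus:
  assumes "ring R" "set L \<subseteq> carrier R \<times> carrier K"
  shows "(\<lambda>p. tfs (map (\<lambda>(x, b). (\<ominus>\<^bsub>R\<^esub> x, b)) L) p + tfs L p) \<in> tensor_rel R K"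
  using assms(2)
proof (induction L)
  case (Cons q L)
  obtain x b where q: "q = (x, b)" by (cases q)
  have "(\<lambda>p. (tfs [(\<ominus>\<^bsub>R\<^esub> x, b)] p + tfs [(x, b)] p) + (tfs (map (\<lambda>(x, b). (\<ominus>\<^bsub>R\<^esub> x, b)) L) p + tfs L p))
      \<in> tensor_rel R K"
    using Cons q by (intro tensor_rel.add[OF tensor_rel_single_uminus[OF assms(1)]]) auto
  moreover have "(\<lambda>p. tfs (map (\<lambda>(x, b). (\<ominus>\<^bsub>R\<^esub> x, b)) (q # L)) p + tfs (q # L) p) =
      (\<lambda>p. (tfs [(\<ominus>\<^bsub>R\<^esub> x, b)] p + tfs [(x, b)] p) + (tfs (map (\<lambda>(x, b). (\<ominus>\<^bsub>R\<^esub> x, b)) L) p + tfs L p))"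
    unfolding q list.map prod.case tfs_Cons[of _ "map _ _"] tfs_Cons[of _ L] by (simp add: fun_eq_iff)
  ultimately show ?case by simp
qed (simp add: tfs_Nil tensor_rel.zero)

text \<open>Lists give only non-negative coefficients, so the sign is moved into the first tensor
  factor.\<close>

lemma representable_uminus:
  assumes "ring R" "representable R K f" shows "representable R K (\<lambda>p. - f p)"
proof -
  interpret ring R by fact
  obtain L where L: "set L \<subseteq> carrier R \<times> carrier K" "(\<lambda>p. tfs L p - f p) \<in> tensor_rel R K"
    using assms(2) unfolding representable_def teq_def by blast
  let ?M = "map (\<lambda>(x, b). (\<ominus>\<^bsub>R\<^esub> x, b)) L"
  have "set ?M \<subseteq> carrier R \<times> carrier K" using L by auto
  moreover have "(\<lambda>p. tfs ?M p - - f p) \<in> tensor_rel R K"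
    using tensor_rel.add[OF tensor_rel_list_uminus[OF assms(1) L(1)] tensor_rel.neg[OF L(2)]] by simp
  ultimately show ?thesis unfolding representable_def teq_def by blast
qed

lemma tnorm_lessE:
  assumes "tnorm R K nr v f < c" "representable R K f"
  obtains L where "set L \<subseteq> carrier R \<times> carrier K" "teq R K (tfs L) f"
    "\<And>x b. (x, b) \<in> set L \<Longrightarrow> nr x * v b < c"
proof -
  let ?A = "{Max (insert 0 ((\<lambda>(a, b). nr a * v b) ` set L)) | L.
       set L \<subseteq> carrier R \<times> carrier K \<and> teq R K (tfs L) f}"
  have "?A \<noteq> {}" using assms(2) by (auto simp: representable_def)
  then obtain L where L: "set L \<subseteq> carrier R \<times> carrier K" "teq R K (tfs L) f"
    "Max (insert 0 ((\<lambda>(a, b). nr a * v b) ` set L)) < c"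
    using cInf_lessD[OF _ assms(1)[unfolded tnorm_def]] by blast
  have "nr x * v b < c" if "(x, b) \<in> set L" for x b
  proof -
    have "nr x * v b \<in> insert 0 ((\<lambda>(a, b). nr a * v b) ` set L)" using that by force
    then show ?thesis using L(3) by (meson List.finite_set Max_ge finite_imageI finite_insert le_less_trans)
  qed
  then show ?thesis using that L by blast
qed

section \<open>The tensor product with the completed field of a minimal seminorm\<close>

locale minimal_point = um_normed_ring R nr a for R :: "('a, 'm) ring_scheme" (structure) and nr a +
  fixes w :: "int poly \<Rightarrow> real" and K :: "('k, 'n) ring_scheme" and v :: "'k \<Rightarrow> real" and \<phi> :: "int poly \<Rightarrow> 'k"
  assumes w_sn: "um_seminorm w" and w_mult: "w (f * g) = w f * w g"
    and ev_notin_ball: "w g \<noteq> 0 \<Longrightarrow> ev g \<notin> ball w (w g)"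
    and K: "complete_valued_field K v"
    and v_add: "\<lbrakk>x \<in> carrier K; y \<in> carrier K\<rbrakk> \<Longrightarrow> v (x \<oplus>\<^bsub>K\<^esub> y) \<le> max (v x) (v y)"
    and \<phi>_closed [simp]: "\<phi> f \<in> carrier K" and \<phi>_one: "\<phi> 1 = \<one>\<^bsub>K\<^esub>"
    and \<phi>_add: "\<phi> (f + g) = \<phi> f \<oplus>\<^bsub>K\<^esub> \<phi> g" and \<phi>_mult: "\<phi> (f * g) = \<phi> f \<otimes>\<^bsub>K\<^esub> \<phi> g"
    and v_\<phi>: "v (\<phi> f) = w f"
    and \<phi>_dense: "\<lbrakk>x \<in> carrier K; e > 0\<rbrakk> \<Longrightarrow>
       \<exists>f g. w g \<noteq> 0 \<and> v (\<phi> g \<otimes>\<^bsub>K\<^esub> x \<ominus>\<^bsub>K\<^esub> \<phi> f) < e * w g"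
begin

sublocale K: field K
  using K by (simp add: complete_valued_field_def)

lemma v_nonneg: "x \<in> carrier K \<Longrightarrow> 0 \<le> v x"
  and v_mult: "x \<in> carrier K \<Longrightarrow> y \<in> carrier K \<Longrightarrow> v (x \<otimes>\<^bsub>K\<^esub> y) = v x * v y"
  using K by (auto simp: complete_valued_field_def)

lemma w_nonneg: "0 \<le> w f" and w_pos: "w g \<noteq> 0 \<Longrightarrow> w g > 0"
  using um_seminormD(1)[OF w_sn, of f] um_seminormD(1)[OF w_sn, of g] by auto

lemma \<phi>_diff: "\<phi> (f - g) = \<phi> f \<ominus>\<^bsub>K\<^esub> \<phi> g"
proof -
  have "\<phi> f = \<phi> (f - g) \<oplus>\<^bsub>K\<^esub> \<phi> g" by (simp flip: \<phi>_add)
  then show ?thesis by (simp add: a_minus_def K.a_assoc K.r_neg)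
qed

lemma v_uminus: assumes "x \<in> carrier K" shows "v (\<ominus>\<^bsub>K\<^esub> x) = v x"
proof -
  have "v (\<ominus>\<^bsub>K\<^esub> \<phi> 1) = 1"
  proof -
    have "\<ominus>\<^bsub>K\<^esub> \<phi> 1 = \<phi> (- 1)"
      using \<phi>_diff[of 0 1] \<phi>_diff[of 1 1] by (simp add: a_minus_def K.r_neg)
    then show ?thesis
      using v_\<phi>[of "- 1"] um_seminormD(4)[OF w_sn, of 1] v_\<phi>[of 1] w_mult[of 1 1] K.one_not_zero K
      by (auto simp: \<phi>_one complete_valued_field_def)
  qed
  then show ?thesis
    using v_mult[of "\<ominus>\<^bsub>K\<^esub> \<phi> 1" x] assms by (simp add: \<phi>_one K.l_minus)
qed

lemma v_diff: "x \<in> carrier K \<Longrightarrow> y \<in> carrier K \<Longrightarrow> v (x \<ominus>\<^bsub>K\<^esub> y) \<le> max (v x) (v y)"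
  unfolding a_minus_def using v_add[of x "\<ominus>\<^bsub>K\<^esub> y"] v_uminus[of y] by simp

text \<open>The fraction \<open>\<alpha> h / g\<close> approximates \<open>h\<close>; the denominator is common to all \<open>h\<close>.\<close>

definition err :: "int poly \<Rightarrow> ('k \<Rightarrow> int poly) \<Rightarrow> 'k \<Rightarrow> 'k" where
  "err g \<alpha> h = \<phi> g \<otimes>\<^bsub>K\<^esub> h \<ominus>\<^bsub>K\<^esub> \<phi> (\<alpha> h)"

text \<open>Since \<open>v (\<phi> g) = w g\<close>, the fractions are within
  \<open>\<delta>\<close> of the elements of \<open>F\<close>; the condition is written without
  division.\<close>

definition approx :: "'k set \<Rightarrow> real \<Rightarrow> int poly \<Rightarrow> ('k \<Rightarrow> int poly) \<Rightarrow> bool" where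
  "approx F \<delta> g \<alpha> \<longleftrightarrow> w g > 0 \<and> (\<forall>h\<in>F. v (err g \<alpha> h) < \<delta> * w g)"

lemma err_closed [simp]: "h \<in> carrier K \<Longrightarrow> err g \<alpha> h \<in> carrier K"
  by (simp add: err_def)

lemma approxD: "approx F \<delta> g \<alpha> \<Longrightarrow> h \<in> F \<Longrightarrow> v (err g \<alpha> h) < \<delta> * w g"
  and approx_pos: "approx F \<delta> g \<alpha> \<Longrightarrow> w g > 0"
  by (auto simp: approx_def)

lemma approx_mono:
  assumes "approx F \<delta> g \<alpha>" "F' \<subseteq> F" "\<delta> \<le> \<delta>'" shows "approx F' \<delta>' g \<alpha>"
proof -
  have "\<delta> * w g \<le> \<delta>' * w g"
    using assms w_nonneg by (intro mult_right_mono) auto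
  then show ?thesis using assms unfolding approx_def by (meson less_le_trans subsetD)
qed

lemma ex_approx:
  assumes "finite F" "F \<subseteq> carrier K" "\<delta> > 0"
  shows "\<exists>g \<alpha>. approx F \<delta> g \<alpha>"
  using assms(1,2)
proof (induction F rule: finite_induct)
  case empty
  have "v \<one>\<^bsub>K\<^esub> \<noteq> 0"
    using K K.one_not_zero unfolding complete_valued_field_def by blast
  then have "w 1 > 0" using v_\<phi>[of 1] w_pos[of 1] by (simp add: \<phi>_one)
  then show ?case unfolding approx_def by (intro exI[of _ 1]) auto
next
  case (insert h F)
  then obtain g \<alpha> where g: "approx F \<delta> g \<alpha>" by auto
  obtain f g' where g': "w g' \<noteq> 0" "v (\<phi> g' \<otimes>\<^bsub>K\<^esub> h \<ominus>\<^bsub>K\<^esub> \<phi> f) < \<delta> * w g'"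
    using \<phi>_dense[of h \<delta>] insert assms(3) by auto
  have scale: "v (\<phi> (q * p) \<otimes>\<^bsub>K\<^esub> x \<ominus>\<^bsub>K\<^esub> \<phi> (q * r)) = w q * v (\<phi> p \<otimes>\<^bsub>K\<^esub> x \<ominus>\<^bsub>K\<^esub> \<phi> r)"
    if "x \<in> carrier K" for q p r x
  proof -
    have "\<phi> (q * p) \<otimes>\<^bsub>K\<^esub> x \<ominus>\<^bsub>K\<^esub> \<phi> (q * r) = \<phi> q \<otimes>\<^bsub>K\<^esub> (\<phi> p \<otimes>\<^bsub>K\<^esub> x \<ominus>\<^bsub>K\<^esub> \<phi> r)"
      using that by (simp add: \<phi>_mult a_minus_def K.r_distr K.r_minus K.m_assoc)
    then show ?thesis using that by (simp add: v_mult v_\<phi>)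
  qed
  \<comment> \<open>Over the common denominator \<open>g * g'\<close> the old numerators gain the
    factor \<open>g'\<close> and the new one gains \<open>g\<close>; errors relative to the
    denominator are unchanged.\<close>
  define \<beta> where "\<beta> x = (if x = h then g * f else g' * \<alpha> x)" for x
  have pos: "w g > 0" "w g' > 0" using approx_pos[OF g] w_pos[OF g'(1)] by auto
  have "v (err (g * g') \<beta> x) < \<delta> * w (g * g')" if "x \<in> insert h F" for x
  proof (cases "x = h")
    case True
    then show ?thesis
      using g'(2) pos insert scale[of h g g' f] by (simp add: err_def \<beta>_def w_mult)
  next
    case False
    then have "v (err (g' * g) \<beta> x) = w g' * v (err g \<alpha> x)"
      using scale[of x g' g "\<alpha> x"] that insert by (auto simp: err_def \<beta>_def)
    also have "\<dots> < w g' * (\<delta> * w g)" using approxD[OF g, of x] pos that False by simp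
    finally show ?thesis by (simp add: w_mult mult_ac)
  qed
  then show ?case unfolding approx_def using pos by (intro exI[of _ "g * g'"] exI[of _ \<beta>]) (auto simp: w_mult)
qed

text \<open>Up to the denominator, the image of \<open>f\<close> in the \<open>\<int>[t]\<close>-module \<open>K \<otimes> R\<close>,
  on which \<open>t\<close> acts on \<open>R\<close> as left multiplication by \<open>a\<close>.\<close>

definition tev :: "('k \<Rightarrow> int poly) \<Rightarrow> ('a \<times> 'k \<Rightarrow> int) \<Rightarrow> 'a" where
  "tev \<alpha> f = (\<Oplus>p\<in>{p. f p \<noteq> 0}. [f p] \<cdot> (ev (\<alpha> (snd p)) \<otimes> fst p))"

lemma tev_superset:
  assumes "finite A" "{p. f p \<noteq> 0} \<subseteq> A" "A \<subseteq> carrier R \<times> carrier K"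
  shows "tev \<alpha> f = (\<Oplus>p\<in>A. [f p] \<cdot> (ev (\<alpha> (snd p)) \<otimes> fst p))"
  unfolding tev_def
  by (rule add.finprod_mono_neutral_cong_left) (use assms in auto)

lemma tev_add:
  assumes "f \<in> fsums R K" "g \<in> fsums R K"
  shows "tev \<alpha> (\<lambda>p. f p + g p) = tev \<alpha> f \<oplus> tev \<alpha> g"
proof -
  let ?A = "{p. f p \<noteq> 0} \<union> {p. g p \<noteq> 0}"
  have A: "finite ?A" "?A \<subseteq> carrier R \<times> carrier K" using assms by (auto simp: fsums_def)
  have "tev \<alpha> (\<lambda>p. f p + g p) = (\<Oplus>p\<in>?A. [(f p + g p)] \<cdot> (ev (\<alpha> (snd p)) \<otimes> fst p))"
    by (rule tev_superset) (use A in auto)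
  also have "\<dots> = (\<Oplus>p\<in>?A. [f p] \<cdot> (ev (\<alpha> (snd p)) \<otimes> fst p) \<oplus> [g p] \<cdot> (ev (\<alpha> (snd p)) \<otimes> fst p))"
    by (rule finsum_cong') (use A in \<open>auto simp: add.int_pow_mult\<close>)
  also have "\<dots> = (\<Oplus>p\<in>?A. [f p] \<cdot> (ev (\<alpha> (snd p)) \<otimes> fst p)) \<oplus> (\<Oplus>p\<in>?A. [g p] \<cdot> (ev (\<alpha> (snd p)) \<otimes> fst p))"
    by (rule finsum_addf) (use A in auto)
  also have "\<dots> = tev \<alpha> f \<oplus> tev \<alpha> g"
    using A tev_superset[of ?A f \<alpha>] tev_superset[of ?A g \<alpha>] by simp
  finally show ?thesis .
qed

lemma tev_closed: assumes "f \<in> fsums R K" shows "tev \<alpha> f \<in> carrier R"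
  unfolding tev_def by (rule finsum_closed) (use assms in \<open>auto simp: fsums_def\<close>)

lemma tev_zero: "tev \<alpha> (\<lambda>_. 0) = \<zero>"
  by (simp add: tev_def)

lemma tev_uminus: assumes "f \<in> fsums R K" shows "tev \<alpha> (\<lambda>p. - f p) = \<ominus> tev \<alpha> f"
proof (rule minus_equality[symmetric])
  show "tev \<alpha> (\<lambda>p. - f p) \<oplus> tev \<alpha> f = \<zero>"
    using tev_add[OF fsums_uminus[OF assms] assms, of \<alpha>] by (simp add: tev_zero)
qed (simp_all add: tev_closed fsums_uminus assms)

lemma tev_diff:
  assumes "f \<in> fsums R K" "g \<in> fsums R K"
  shows "tev \<alpha> (\<lambda>p. f p - g p) = tev \<alpha> f \<ominus> tev \<alpha> g"
  using tev_add[OF assms(1) fsums_uminus[OF assms(2)]] by (simp add: a_minus_def tev_uminus assms)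

lemma fsums_diff: "f \<in> fsums R K \<Longrightarrow> g \<in> fsums R K \<Longrightarrow> (\<lambda>p. f p - g p) \<in> fsums R K"
  using fsums_add[OF _ fsums_uminus, of f R K g] by simp

lemma tev_single: "x \<in> carrier R \<Longrightarrow> b \<in> carrier K \<Longrightarrow> tev \<alpha> (tfs [(x, b)]) = ev (\<alpha> b) \<otimes> x"
  using tev_superset[of "{(x, b)}" "tfs [(x, b)]" \<alpha>] by (auto simp: tfs_single)

text \<open>\<open>tev \<alpha>\<close> does not respect the tensor relations, because
  \<open>\<alpha>\<close> need not be additive. So smallness quantifies over all approximations that
  are good enough on some finite set. The radius is \<open>w g\<close> because the denominator
  \<open>g\<close> has not been divided out.\<close>

definition small :: "('a \<times> 'k \<Rightarrow> int) \<Rightarrow> bool" where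
  "small f \<longleftrightarrow> f \<in> fsums R K \<and> (\<exists>F \<delta>. finite F \<and> F \<subseteq> carrier K \<and> \<delta> > 0 \<and>
     (\<forall>g \<alpha>. approx F \<delta> g \<alpha> \<longrightarrow> tev \<alpha> f \<in> ball w (w g)))"

lemma smallI:
  assumes "f \<in> fsums R K" "finite F" "F \<subseteq> carrier K" "\<delta> > 0"
    and "\<And>g \<alpha>. approx F \<delta> g \<alpha> \<Longrightarrow> tev \<alpha> f \<in> ball w (w g)"
  shows "small f"
  using assms unfolding small_def by blast

lemma small_zero: "small (\<lambda>_. 0)"
  by (rule smallI[of _ "{}" 1]) (auto simp: fsums_zero tev_zero ball.zero)

lemma small_uminus: "small f \<Longrightarrow> small (\<lambda>p. - f p)"
  unfolding small_def using fsums_uminus tev_uminus ball_uminus by metis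

lemma small_add: assumes "small f" "small g" shows "small (\<lambda>p. f p + g p)"
proof -
  obtain F \<delta> where F: "finite F" "F \<subseteq> carrier K" "\<delta> > 0" "\<And>h \<alpha>. approx F \<delta> h \<alpha> \<Longrightarrow> tev \<alpha> f \<in> ball w (w h)"
    using assms(1) unfolding small_def by blast
  obtain F' \<delta>' where F': "finite F'" "F' \<subseteq> carrier K" "\<delta>' > 0" "\<And>h \<alpha>. approx F' \<delta>' h \<alpha> \<Longrightarrow> tev \<alpha> g \<in> ball w (w h)"
    using assms(2) unfolding small_def by blast
  have fg: "f \<in> fsums R K" "g \<in> fsums R K" using assms by (auto simp: small_def)
  show ?thesis
  proof (rule smallI[of _ "F \<union> F'" "min \<delta> \<delta>'"])
    fix h \<alpha> assume "approx (F \<union> F') (min \<delta> \<delta>') h \<alpha>"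
    then have "approx F \<delta> h \<alpha>" "approx F' \<delta>' h \<alpha>" by (auto elim: approx_mono)
    then show "tev \<alpha> (\<lambda>p. f p + g p) \<in> ball w (w h)"
      using F F' fg by (simp add: tev_add ball_add)
  qed (use F F' fg in \<open>auto intro: fsums_add\<close>)
qed

lemma small_diff: "small f \<Longrightarrow> small g \<Longrightarrow> small (\<lambda>p. f p - g p)"
  using small_add[OF _ small_uminus, of f g] by simp

lemma ball_if_bounded:
  assumes "w z \<le> \<delta> * w g" "w g > 0" "x \<in> carrier R" "\<delta> * nr x < 1"
  shows "ev z \<otimes> x \<in> ball w (w g)"
proof (rule ball_ev_mult)
  have "w z * nr x \<le> (\<delta> * w g) * nr x"
    using assms nr_nonneg by (intro mult_right_mono) auto
  also have "\<dots> = w g * (\<delta> * nr x)" by simp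
  also have "\<dots> < w g" using assms by simp
  finally show "w z * nr x < w g" .
qed fact

lemma ex_radius: assumes "x \<in> carrier R" obtains \<delta> where "\<delta> > 0" "\<delta> * nr x < 1"
proof (rule that[of "1 / (nr x + 1)"])
  have "nr x + 1 > 0" using nr_nonneg[OF assms] by simp
  then show "1 / (nr x + 1) > 0" "1 / (nr x + 1) * nr x < 1" by (auto simp: field_simps)
qed

text \<open>The numerator satisfies \<open>w (\<alpha> b) \<le> max (v b) \<delta> * w g\<close>,
  and both \<open>v b\<close> and \<open>\<delta>\<close> have a product with \<open>nr x\<close>
  below 1.\<close>

lemma small_single:
  assumes x: "x \<in> carrier R" and b: "b \<in> carrier K" and less: "nr x * v b < 1"
  shows "small (tfs [(x, b)])"
proof -
  obtain \<delta> where \<delta>: "\<delta> > 0" "\<delta> * nr x < 1" using ex_radius[OF x] .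
  show ?thesis
  proof (rule smallI[of _ "{b}" \<delta>])
    fix g \<alpha> assume g: "approx {b} \<delta> g \<alpha>"
    have "\<phi> (\<alpha> b) = \<phi> g \<otimes>\<^bsub>K\<^esub> b \<ominus>\<^bsub>K\<^esub> err g \<alpha> b"
      using b by (simp add: err_def K.minus_minus_cancel)
    then have "w (\<alpha> b) \<le> max (v (\<phi> g \<otimes>\<^bsub>K\<^esub> b)) (v (err g \<alpha> b))"
      using v_diff[of "\<phi> g \<otimes>\<^bsub>K\<^esub> b" "err g \<alpha> b"] v_\<phi>[of "\<alpha> b"] b by simp
    also have "\<dots> \<le> max (v b) \<delta> * w g"
    proof -
      have "w g * v b \<le> w g * max (v b) \<delta>" "w g * \<delta> \<le> w g * max (v b) \<delta>"
        using w_nonneg by (simp_all add: mult_left_mono)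
      then show ?thesis
        using approxD[OF g, of b] b by (simp add: v_mult v_\<phi> mult.commute)
    qed
    finally show "tev \<alpha> (tfs [(x, b)]) \<in> ball w (w g)"
      unfolding tev_single[OF x b]
      by (rule ball_if_bounded[OF _ approx_pos[OF g] x]) (use less \<delta> in \<open>auto simp: max_def mult.commute\<close>)
  qed (use x b \<delta> in \<open>auto intro: fsums_single\<close>)
qed

text \<open>On relations in the first factor \<open>tev \<alpha>\<close> vanishes for every
  \<open>\<alpha>\<close>. On those in the second it is \<open>ev z \<otimes> x\<close>, where
  \<open>z\<close> is the failure of additivity of \<open>\<alpha>\<close>; \<open>\<phi> z\<close>
  is a combination of three errors, so \<open>w z\<close> is small.\<close>

lemma small_tensor_rel: "f \<in> tensor_rel R K \<Longrightarrow> small f"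
proof (induction rule: tensor_rel.induct)
  case (left x x' b)
  show ?case
  proof (rule smallI[of _ "{}" 1])
    fix g \<alpha>
    have "ev (\<alpha> b) \<otimes> (x \<oplus> x') \<ominus> ev (\<alpha> b) \<otimes> x \<ominus> ev (\<alpha> b) \<otimes> x' = \<zero>"
      using left by (simp add: r_distr a_minus_def a_ac r_neg1 r_neg)
    then show "tev \<alpha> (\<lambda>p. tfs [(x \<oplus> x', b)] p - tfs [(x, b)] p - tfs [(x', b)] p) \<in> ball w (w g)"
      using left by (simp add: tev_diff tev_single fsums_diff fsums_single ball.zero)
  qed (use left in \<open>auto intro!: fsums_diff fsums_single\<close>)
next
  case (right x b b')
  obtain \<delta> where \<delta>: "\<delta> > 0" "\<delta> * nr x < 1" using ex_radius[OF right(1)] .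
  let ?s = "b \<oplus>\<^bsub>K\<^esub> b'"
  show ?case
  proof (rule smallI[of _ "{b, b', ?s}" \<delta>])
    fix g \<alpha> assume g: "approx {b, b', ?s} \<delta> g \<alpha>"
    let ?z = "\<alpha> ?s - \<alpha> b - \<alpha> b'"
    have "\<phi> ?z = err g \<alpha> b \<oplus>\<^bsub>K\<^esub> err g \<alpha> b' \<ominus>\<^bsub>K\<^esub> err g \<alpha> ?s"
      using right by (simp add: \<phi>_diff err_def K.r_distr K.add_minus_cancel)
    then have "w ?z \<le> max (max (v (err g \<alpha> b)) (v (err g \<alpha> b'))) (v (err g \<alpha> ?s))"
      using v_diff[of "err g \<alpha> b \<oplus>\<^bsub>K\<^esub> err g \<alpha> b'" "err g \<alpha> ?s"] v_add[of "err g \<alpha> b" "err g \<alpha> b'"]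
        v_\<phi>[of ?z] right by auto
    also have "\<dots> \<le> \<delta> * w g"
      using approxD[OF g, of b] approxD[OF g, of b'] approxD[OF g, of ?s] by simp
    finally have "ev ?z \<otimes> x \<in> ball w (w g)"
      by (rule ball_if_bounded[OF _ approx_pos[OF g] right(1) \<delta>(2)])
    moreover have "ev ?z \<otimes> x = ev (\<alpha> ?s) \<otimes> x \<ominus> ev (\<alpha> b) \<otimes> x \<ominus> ev (\<alpha> b') \<otimes> x"
      using right by (simp add: ev_diff a_minus_def l_distr l_minus)
    ultimately show "tev \<alpha> (\<lambda>p. tfs [(x, ?s)] p - tfs [(x, b)] p - tfs [(x, b')] p) \<in> ball w (w g)"
      using right by (simp add: tev_diff tev_single fsums_diff fsums_single)
  qed (use right \<delta> in \<open>auto intro!: fsums_diff fsums_single\<close>)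
qed (auto intro: small_zero small_add small_uminus)

abbreviation s where "s \<equiv> \<phi> [:0, 1:]"

text \<open>This is the product of \<open>1 \<otimes> s - a \<otimes> 1\<close> with a simple
  tensor. As \<open>t\<close> acts on \<open>R\<close> through \<open>a\<close>, the image is
  \<open>ev z \<otimes> x\<close>, where \<open>z\<close> compares the numerator of
  \<open>s b\<close> with \<open>t\<close> times that of \<open>b\<close>, so that
  \<open>\<phi> z\<close> consists of errors only.\<close>

lemma small_shift:
  assumes x: "x \<in> carrier R" and b: "b \<in> carrier K"
  shows "small (\<lambda>q. tfs [(x, s \<otimes>\<^bsub>K\<^esub> b)] q - tfs [(a \<otimes> x, b)] q)"
proof -
  obtain \<delta> where \<delta>: "\<delta> > 0" "\<delta> * nr x < 1" using ex_radius[OF x] .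
  \<comment> \<open>Multiplication by \<open>s\<close> scales an error by \<open>v s\<close>;
    \<open>c \<ge> 1\<close> also covers the error at \<open>s b\<close> itself.\<close>
  define c where "c = max 1 (v s)"
  have c: "c \<ge> 1" "v s \<le> c" by (auto simp: c_def)
  show ?thesis
  proof (rule smallI[of _ "{b, s \<otimes>\<^bsub>K\<^esub> b}" "\<delta> / c"])
    fix g \<alpha> assume g: "approx {b, s \<otimes>\<^bsub>K\<^esub> b} (\<delta> / c) g \<alpha>"
    let ?z = "\<alpha> (s \<otimes>\<^bsub>K\<^esub> b) - [:0, 1:] * \<alpha> b"
    have "\<phi> ?z = s \<otimes>\<^bsub>K\<^esub> err g \<alpha> b \<ominus>\<^bsub>K\<^esub> err g \<alpha> (s \<otimes>\<^bsub>K\<^esub> b)"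
      unfolding \<phi>_diff \<phi>_mult err_def using b
      by (simp add: K.mult_minus_cancel)
    then have "w ?z \<le> max (v s * v (err g \<alpha> b)) (v (err g \<alpha> (s \<otimes>\<^bsub>K\<^esub> b)))"
      using v_diff[of "s \<otimes>\<^bsub>K\<^esub> err g \<alpha> b" "err g \<alpha> (s \<otimes>\<^bsub>K\<^esub> b)"] v_\<phi>[of ?z] b by (simp add: v_mult)
    also have "\<dots> \<le> \<delta> * w g"
    proof -
      have e: "v (err g \<alpha> b) \<le> \<delta> / c * w g" "v (err g \<alpha> (s \<otimes>\<^bsub>K\<^esub> b)) \<le> \<delta> / c * w g"
        using approxD[OF g, of b] approxD[OF g, of "s \<otimes>\<^bsub>K\<^esub> b"] by auto
      have "v s * v (err g \<alpha> b) \<le> c * (\<delta> / c * w g)"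
        using e(1) c b v_nonneg by (intro mult_mono) auto
      moreover have "\<delta> / c * w g \<le> \<delta> * w g"
        using c \<delta> w_nonneg by (intro mult_right_mono) (auto simp: field_simps)
      ultimately show ?thesis using e(2) c by simp
    qed
    finally have "ev ?z \<otimes> x \<in> ball w (w g)"
      by (rule ball_if_bounded[OF _ approx_pos[OF g] x \<delta>(2)])
    moreover have "ev ?z \<otimes> x = ev (\<alpha> (s \<otimes>\<^bsub>K\<^esub> b)) \<otimes> x \<ominus> ev (\<alpha> b) \<otimes> (a \<otimes> x)"
    proof -
      have "ev ([:0, 1:] * \<alpha> b) = ev (\<alpha> b) \<otimes> a"
        using ev_commute[of "[:0, 1:]" "\<alpha> b"] unfolding ev_mult ev_X .
      then show ?thesis using x unfolding ev_diff by (simp add: a_minus_def l_distr l_minus m_assoc)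
    qed
    ultimately show "tev \<alpha> (\<lambda>q. tfs [(x, s \<otimes>\<^bsub>K\<^esub> b)] q - tfs [(a \<otimes> x, b)] q) \<in> ball w (w g)"
      using x b by (simp add: tev_diff tev_single fsums_single)
  qed (use x b \<delta> c in \<open>auto intro!: fsums_diff fsums_single\<close>)
qed

text \<open>The numerator approximating 1 differs from \<open>g\<close> by less than
  \<open>w g\<close>, so the ultrametric inequality gives it the value \<open>w g\<close>. The image
  of \<open>1 \<otimes> 1\<close> is \<open>ev\<close> of this numerator, which
  \<open>ev_notin_ball\<close> keeps out of the ball of radius \<open>w g\<close>.\<close>

lemma not_small_tone: "\<not> small (tone R K)"
proof
  assume "small (tone R K)"
  then obtain F \<delta> where F: "finite F" "F \<subseteq> carrier K" "\<delta> > 0"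
    "\<And>g \<alpha>. approx F \<delta> g \<alpha> \<Longrightarrow> tev \<alpha> (tone R K) \<in> ball w (w g)"
    unfolding small_def by blast
  \<comment> \<open>One approximation has to meet both demands: tolerance \<open>\<delta>\<close> on
    \<open>F\<close>, and tolerance 1 at the unit of \<open>K\<close>.\<close>
  obtain g \<alpha> where g: "approx (insert \<one>\<^bsub>K\<^esub> F) (min \<delta> 1) g \<alpha>"
    using ex_approx[of "insert \<one>\<^bsub>K\<^esub> F" "min \<delta> 1"] F by auto
  then have "approx F \<delta> g \<alpha>" by (rule approx_mono) auto
  from F(4)[OF this] have mem: "ev (\<alpha> \<one>\<^bsub>K\<^esub>) \<in> ball w (w g)"
    by (simp add: tone_def tev_single)
  have "approx {\<one>\<^bsub>K\<^esub>} 1 g \<alpha>" using g by (rule approx_mono) auto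
  then have close: "w (g - \<alpha> \<one>\<^bsub>K\<^esub>) < w g"
    using approxD[of "{\<one>\<^bsub>K\<^esub>}" 1 g \<alpha> "\<one>\<^bsub>K\<^esub>"] v_\<phi>[of "g - \<alpha> \<one>\<^bsub>K\<^esub>"] by (simp add: err_def \<phi>_diff)
  have "w (\<alpha> \<one>\<^bsub>K\<^esub>) = w g"
    using close um_seminormD(7)[OF w_sn, of g "g - \<alpha> \<one>\<^bsub>K\<^esub>"] um_seminormD(5)[OF w_sn, of "g - \<alpha> \<one>\<^bsub>K\<^esub>" "\<alpha> \<one>\<^bsub>K\<^esub>"]
    by auto
  then show False using ev_notin_ball[of "\<alpha> \<one>\<^bsub>K\<^esub>"] mem approx_pos[OF g] by simp
qed

lemma small_tfs:
  assumes "set L \<subseteq> carrier R \<times> carrier K" "\<And>x b. (x, b) \<in> set L \<Longrightarrow> nr x * v b < 1"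
  shows "small (tfs L)"
  using assms
proof (induction L)
  case (Cons p L)
  then have "small (tfs [p])" by (cases p) (auto intro: small_single)
  then show ?case using Cons by (subst tfs_Cons) (intro small_add, auto)
qed (simp add: tfs_Nil small_zero)

text \<open>A representation with all terms below 1 is small, and it differs from \<open>f\<close>
  by a tensor relation, which is small as well.\<close>

lemma tnorm_less_1_small:
  assumes "tnorm R K nr v f < 1" "representable R K f"
  shows "small f"
proof -
  obtain L where L: "set L \<subseteq> carrier R \<times> carrier K" "teq R K (tfs L) f"
    "\<And>x b. (x, b) \<in> set L \<Longrightarrow> nr x * v b < 1"
    using tnorm_lessE[OF assms] by blast
  show ?thesis
    using small_diff[OF small_tfs[OF L(1,3)] small_tensor_rel[OF L(2)[unfolded teq_def]]] by simp
qed

lemma tcompl_nonzero: "tcompl_nonzero R K nr v"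
proof -
  have "representable R K (tone R K)"
    unfolding tone_def by (rule representable_single) simp
  then have "\<not> tnorm R K nr v (tone R K) < 1"
    using tnorm_less_1_small not_small_tone by blast
  then show ?thesis unfolding tcompl_nonzero_def by auto
qed

text \<open>Every multiple of \<open>1 \<otimes> s - a \<otimes> 1\<close> is an integer combination
  of elements as in \<open>small_shift\<close>, hence small. If one came within distance less than 1
  of \<open>1 \<otimes> 1\<close>, the difference would be small too, and so would
  \<open>1 \<otimes> 1\<close>.\<close>

lemma not_tcompl_invertible: "\<not> tcompl_invertible R K nr v (telem R K a s)"
proof
  assume "tcompl_invertible R K nr v (telem R K a s)"
  then obtain y where y: "\<And>n. y n \<in> fsums R K"
    and lim: "(\<lambda>n. tnorm R K nr v (tdiff (tmult R K (telem R K a s) (y n)) (tone R K))) \<longlonglongrightarrow> 0"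
    unfolding tcompl_invertible_def by blast
  obtain n where n: "tnorm R K nr v (tdiff (tmult R K (telem R K a s) (y n)) (tone R K)) < 1"
    using order_tendstoD(2)[OF lim, of 1] by (auto simp: eventually_sequentially)
  let ?Y = "{p. y n p \<noteq> 0}" and ?z = "tmult R K (telem R K a s) (y n)"
  define h where "h p q = tfs [(fst p, s \<otimes>\<^bsub>K\<^esub> snd p)] q - tfs [(a \<otimes> fst p, snd p)] q" for p q
  have Y: "finite ?Y" "?Y \<subseteq> carrier R \<times> carrier K" using y[of n] by (auto simp: fsums_def)
  have z: "?z = (\<lambda>q. \<Sum>p\<in>?Y. y n p * h p q)"
    unfolding tmult_telem[OF y[of n]] h_def using Y by (intro ext sum.cong) auto
  have "small ?z"
    unfolding z
    by (rule closed_under_int_combination[where Q = small])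
       (use Y in \<open>auto intro: small_zero small_add small_uminus simp: h_def[abs_def] intro!: small_shift\<close>)
  moreover have "representable R K ?z"
    unfolding z
  proof (rule closed_under_int_combination[where Q = "representable R K"])
    fix p assume "p \<in> ?Y"
    then have "p \<in> carrier R \<times> carrier K" using Y by blast
    then show "representable R K (h p)"
      unfolding h_def
      using representable_add[OF representable_single[of "(fst p, s \<otimes>\<^bsub>K\<^esub> snd p)" R K]
        representable_uminus[OF ring_axioms representable_single[of "(a \<otimes> fst p, snd p)" R K]]] by auto
  qed (use Y in \<open>auto intro: representable_zero representable_add representable_uminus ring_axioms\<close>)
  then have "representable R K (tdiff ?z (tone R K))"
    using representable_add[OF _ representable_uminus[OF ring_axioms representable_single], of K ?z "(\<one>, \<one>\<^bsub>K\<^esub>)"]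
    by (simp add: tdiff_def tone_def)
  then have "small (tdiff ?z (tone R K))"
    using n tnorm_less_1_small by blast
  ultimately have "small (\<lambda>q. ?z q - tdiff ?z (tone R K) q)"
    by (rule small_diff)
  then show False using not_small_tone by (simp add: tdiff_def)
qed

end

section \<open>Non-emptiness of the spectrum\<close>

lemma sigma_um_nonempty:
  fixes R (structure)
  assumes "ring R" "a \<in> carrier R"
    and "\<And>x. x \<in> carrier R \<Longrightarrow> 0 \<le> nr x" "nr \<zero> = 0" "nr \<one> = 1"
    and "\<And>x. x \<in> carrier R \<Longrightarrow> nr (\<ominus> x) = nr x"
    and "\<And>x y. x \<in> carrier R \<Longrightarrow> y \<in> carrier R \<Longrightarrow> nr (x \<oplus> y) \<le> max (nr x) (nr y)"
    and "\<And>x y. x \<in> carrier R \<Longrightarrow> y \<in> carrier R \<Longrightarrow> nr (x \<otimes> y) \<le> nr x * nr y"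
  shows "sigma_um R nr a \<noteq> {}"
proof -
  interpret um_normed_ring R nr a
    using assms by (intro um_normed_ring.intro um_normed_ring_axioms.intro) auto
  obtain w where adm: "admissible w" and minimal: "\<And>w'. admissible w' \<Longrightarrow> w' \<le> w \<Longrightarrow> w' = w"
    using ex_minimal_admissible by auto
  \<comment> \<open>The spectral point is the image of \<open>t\<close> under \<open>\<phi>\<close>,
    in a field whose carrier type is the one required by \<open>sigma_um\<close>.\<close>
  obtain K :: "real ring" and v \<phi> where "complete_valued_field K v"
    "\<And>x y. x \<in> carrier K \<Longrightarrow> y \<in> carrier K \<Longrightarrow> v (x \<oplus>\<^bsub>K\<^esub> y) \<le> max (v x) (v y)"
    "\<And>f. \<phi> f \<in> carrier K" "\<phi> 1 = \<one>\<^bsub>K\<^esub>"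
    "\<And>f g. \<phi> (f + g) = \<phi> f \<oplus>\<^bsub>K\<^esub> \<phi> g" "\<And>f g. \<phi> (f * g) = \<phi> f \<otimes>\<^bsub>K\<^esub> \<phi> g"
    "\<And>f. v (\<phi> f) = w f"
    "\<And>x e. x \<in> carrier K \<Longrightarrow> e > 0 \<Longrightarrow>
       \<exists>f g. w g \<noteq> 0 \<and> v (\<phi> g \<otimes>\<^bsub>K\<^esub> x \<ominus>\<^bsub>K\<^esub> \<phi> f) < e * w g"
    using ex_completion[OF minimal_um_seminorm[OF adm minimal] minimal_mult[OF adm minimal] minimal_one[OF adm minimal] countable_int_poly]
    by metis
  then interpret minimal_point R nr a w K v \<phi>
    using minimal_um_seminorm[OF adm minimal] minimal_mult[OF adm minimal] minimal_ev_notin_ball[OF adm minimal]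
    by (intro minimal_point.intro minimal_point_axioms.intro um_normed_ring_axioms) auto
  show ?thesis
    using K tcompl_nonzero not_tcompl_invertible \<phi>_closed unfolding sigma_um_def by blast
qed

theorem theorem4p4:
  fixes R :: "('r, 'm) ring_scheme" and nr :: "'r \<Rightarrow> real"
    and S :: "('s, 'n) ring_scheme"
  shows "(banach_ring R nr \<and> ultrametric R nr \<and> regular R nr \<longrightarrow>
            (\<forall>a\<in>carrier R. sigma_um R nr a \<noteq> {}))
       \<and> (ring S \<and> \<one>\<^bsub>S\<^esub> \<noteq> \<zero>\<^bsub>S\<^esub> \<longrightarrow>
            (\<forall>a\<in>carrier S. sigma_um S (trivial_norm S) a \<noteq> {}))"
proof (intro conjI impI ballI; (elim conjE)?)
  fix a assume "banach_ring R nr" "ultrametric R nr" "a \<in> carrier R"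
  then show "sigma_um R nr a \<noteq> {}"
    unfolding banach_ring_def ultrametric_def
    by (intro sigma_um_nonempty) (auto simp: ring.ring_simprules)
next
  fix a assume S: "ring S" "\<one>\<^bsub>S\<^esub> \<noteq> \<zero>\<^bsub>S\<^esub>" "a \<in> carrier S"
  interpret ring S by fact
  \<comment> \<open>This gives the invariance of the trivial norm under negation.\<close>
  have "x = \<zero>\<^bsub>S\<^esub>" if "x \<in> carrier S" "\<ominus>\<^bsub>S\<^esub> x = \<zero>\<^bsub>S\<^esub>" for x
    using that by (metis minus_minus minus_zero)
  then show "sigma_um S (trivial_norm S) a \<noteq> {}"
    using S by (intro sigma_um_nonempty) (auto simp: trivial_norm_def)
qed

end
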